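(* Let $R$ be a complete discrete valuation ring with perfect residue field, fraction field $K$ and normalized valuation $v$. Let $E/K$ be an elliptic curve with additive reduction. Then $E$ has a minimal Weierstrass model over $R$, $$y^2+a_1xy+a_3y=x^3+a_2x^2+a_4x+a_6,$$ such that, writing $m=\min_{i\in\{1,2,3,4,6\}} \frac{v(a_i)}{i}$, $b_6=a_3^2+4a_6$ and $\delta=\operatorname{Disc}(x^3+a_2x^2+a_4x+a_6)$, the following holds according to the Kodaira type of $E$: - type $\mathrm{II}$: $m=\tfrac16$; - type $\mathrm{III}$: $m=\tfrac14$; - type $\mathrm{IV}$: $m=\tfrac13$ and $v(b_6)=2$; - type $\mathrm{I}_0^*$: $m=\tfrac12$ and $v(\delta)=6$; - type $\mathrm{I}_n^*$ with $n>0$: $m=\tfrac12$, $v(\delta)>6$ and $v(a_2^2-3a_4)=2$; - type $\mathrm{IV}^*$: $m=\tfrac23$ and $v(b_6)=4$; - type $\mathrm{III}^*$: $m=\tfrac34$; - type $\mathrm{II}^*$: $m=\tfrac56$. Conversely, if a Weierstrass equation $y^2+a_1xy+a_3y=x^3+a_2x^2+a_4x+a_6$ with $a_i\in K$ defining an elliptic curve $E/K$ satisfies one of the eight conditions listed above, then it is a minimal Weierstrass model of $E$ over $R$ and $E$ has the corresponding Kodaira type.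
   Context: Kodaira types are those of the special fibre of the minimal regular model (as determined by Tate's algorithm). A minimal Weierstrass model over $R$ is a Weierstrass equation with all $a_i\in R$ whose discriminant has minimal valuation among such models. If $a_i=0$ then $v(a_i)=\infty$. $\operatorname{Disc}$ denotes the discriminant of a polynomial. *)

theory Defs
  imports Complex_Main "HOL-Library.Extended_Real" "HOL-Computational_Algebra.Primes"
begin

text \<open>The field K is a type 'k; the normalized valuation is v :: 'k => ereal with
 v 0 = infinity. R = {x. v x >= 0}, maximal ideal {x. v x > 0}.\<close>

definition discrete_valuation :: "('k::field \<Rightarrow> ereal) \<Rightarrow> bool" where
  "discrete_valuation v \<longleftrightarrow>
     (\<forall>x. v x = \<infinity> \<longleftrightarrow> x = 0) \<and>
     (\<forall>x. x \<noteq> 0 \<longrightarrow> (\<exists>n::int. v x = ereal (of_int n))) \<and>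
     (\<forall>x y. v (x * y) = v x + v y) \<and>
     (\<forall>x y. min (v x) (v y) \<le> v (x + y)) \<and>
     (\<exists>\<pi>. v \<pi> = 1)"

definition valuation_complete :: "('k::field \<Rightarrow> ereal) \<Rightarrow> bool" where
  "valuation_complete v \<longleftrightarrow>
     (\<forall>f :: nat \<Rightarrow> 'k.
        (\<forall>N::int. \<exists>M. \<forall>m\<ge>M. \<forall>n\<ge>M. ereal (of_int N) \<le> v (f m - f n)) \<longrightarrow>
        (\<exists>L. \<forall>N::int. \<exists>M. \<forall>n\<ge>M. ereal (of_int N) \<le> v (f n - L)))"

text \<open>The residue field R/m has characteristic p iff v(p) > 0; it is perfect iff
 (in characteristic p) every residue class is a p-th power.\<close>
definition perfect_residue_field :: "('k::field \<Rightarrow> ereal) \<Rightarrow> bool" where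
  "perfect_residue_field v \<longleftrightarrow>
     (\<forall>p::nat. prime p \<and> 0 < v (of_nat p) \<longrightarrow>
        (\<forall>x. 0 \<le> v x \<longrightarrow> (\<exists>y. 0 \<le> v y \<and> 0 < v (y ^ p - x))))"

definition complete_dvf :: "('k::field \<Rightarrow> ereal) \<Rightarrow> bool" where
  "complete_dvf v \<longleftrightarrow> discrete_valuation v \<and> valuation_complete v \<and> perfect_residue_field v"

text \<open>W a1 a2 a3 a4 a6 stands for y^2 + a1 xy + a3 y = x^3 + a2 x^2 + a4 x + a6.\<close>
datatype 'k weq = W (wa1: 'k) (wa2: 'k) (wa3: 'k) (wa4: 'k) (wa6: 'k)

definition wb2 :: "'k::comm_ring_1 weq \<Rightarrow> 'k" where
  "wb2 e = wa1 e ^ 2 + 4 * wa2 e"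
definition wb4 :: "'k::comm_ring_1 weq \<Rightarrow> 'k" where
  "wb4 e = 2 * wa4 e + wa1 e * wa3 e"
definition wb6 :: "'k::comm_ring_1 weq \<Rightarrow> 'k" where
  "wb6 e = wa3 e ^ 2 + 4 * wa6 e"
definition wb8 :: "'k::comm_ring_1 weq \<Rightarrow> 'k" where
  "wb8 e = wa1 e ^ 2 * wa6 e + 4 * wa2 e * wa6 e - wa1 e * wa3 e * wa4 e
          + wa2 e * wa3 e ^ 2 - wa4 e ^ 2"
definition wc4 :: "'k::comm_ring_1 weq \<Rightarrow> 'k" where
  "wc4 e = wb2 e ^ 2 - 24 * wb4 e"
definition wdisc :: "'k::comm_ring_1 weq \<Rightarrow> 'k" where
  "wdisc e = - (wb2 e ^ 2 * wb8 e) - 8 * wb4 e ^ 3 - 27 * wb6 e ^ 2 + 9 * wb2 e * wb4 e * wb6 e"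

definition disc_monic_cubic :: "'k::comm_ring_1 \<Rightarrow> 'k \<Rightarrow> 'k \<Rightarrow> 'k" where
  "disc_monic_cubic b c d = b^2 * c^2 - 4 * c^3 - 4 * b^3 * d - 27 * d^2 + 18 * b * c * d"

text \<open>Standard change of variables x = u^2 x' + r, y = u^3 y' + u^2 s x' + t.\<close>
definition wchange :: "'k::field weq \<Rightarrow> 'k \<Rightarrow> 'k \<Rightarrow> 'k \<Rightarrow> 'k \<Rightarrow> 'k weq" where
  "wchange e u r s t =
     (let a1 = wa1 e; a2 = wa2 e; a3 = wa3 e; a4 = wa4 e; a6 = wa6 e in
      W ((a1 + 2*s) / u)
        ((a2 - s*a1 + 3*r - s^2) / u^2)
        ((a3 + r*a1 + 2*t) / u^3)
        ((a4 - s*a3 + 2*r*a2 - (t + r*s)*a1 + 3*r^2 - 2*s*t) / u^4)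
        ((a6 + r*a4 + r^2*a2 + r^3 - t*a3 - t^2 - r*t*a1) / u^6))"

definition weq_iso :: "'k::field weq \<Rightarrow> 'k weq \<Rightarrow> bool" where
  "weq_iso e e' \<longleftrightarrow> (\<exists>u r s t. u \<noteq> 0 \<and> e' = wchange e u r s t)"

definition integral_weq :: "('k::field \<Rightarrow> ereal) \<Rightarrow> 'k weq \<Rightarrow> bool" where
  "integral_weq v e \<longleftrightarrow> 0 \<le> v (wa1 e) \<and> 0 \<le> v (wa2 e) \<and> 0 \<le> v (wa3 e)
                          \<and> 0 \<le> v (wa4 e) \<and> 0 \<le> v (wa6 e)"

definition minimal_model :: "('k::field \<Rightarrow> ereal) \<Rightarrow> 'k weq \<Rightarrow> bool" where
  "minimal_model v e \<longleftrightarrow> integral_weq v e \<and>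
     (\<forall>e'. weq_iso e e' \<and> integral_weq v e' \<longrightarrow> v (wdisc e) \<le> v (wdisc e'))"

text \<open>Additive reduction: a minimal model has cuspidal reduction, i.e. v(Disc) > 0 and v(c4) > 0.\<close>
definition additive_reduction :: "('k::field \<Rightarrow> ereal) \<Rightarrow> 'k weq \<Rightarrow> bool" where
  "additive_reduction v e \<longleftrightarrow>
     (\<exists>e'. weq_iso e e' \<and> minimal_model v e' \<and> 0 < v (wdisc e') \<and> 0 < v (wc4 e'))"

datatype kodaira = II | III | IV | I0s | Ins_pos | IVs | IIIs | IIs
  (* I0s = I_0^*, Ins_pos = I_n^* with n > 0, IVs = IV^*, IIIs = III^*, IIs = II^* *)

text \<open>Normalisation reached after step 2 of Tate's algorithm (singular point at (0,0))
 in the additive case.\<close>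
definition tate_N2 :: "('k::field \<Rightarrow> ereal) \<Rightarrow> 'k weq \<Rightarrow> bool" where
  "tate_N2 v e \<longleftrightarrow> 1 \<le> v (wa3 e) \<and> 1 \<le> v (wa4 e) \<and> 1 \<le> v (wa6 e)
                     \<and> 1 \<le> v (wdisc e) \<and> 1 \<le> v (wb2 e)"

definition tate_N6 :: "('k::field \<Rightarrow> ereal) \<Rightarrow> 'k weq \<Rightarrow> bool" where
  "tate_N6 v e \<longleftrightarrow> 1 \<le> v (wa1 e) \<and> 1 \<le> v (wa2 e) \<and> 2 \<le> v (wa3 e)
                     \<and> 2 \<le> v (wa4 e) \<and> 3 \<le> v (wa6 e)"

text \<open>P(T) = T^3 + a2/pi T^2 + a4/pi^2 T + a6/pi^3 reduces modulo pi to (T-alpha)^2 (T-beta),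
 alpha, beta in R. (Over the perfect residue field, repeated roots of P are rational.)\<close>
definition tate_P_factor :: "('k::field \<Rightarrow> ereal) \<Rightarrow> 'k \<Rightarrow> 'k weq \<Rightarrow> 'k \<Rightarrow> 'k \<Rightarrow> bool" where
  "tate_P_factor v \<pi> e \<alpha> \<beta> \<longleftrightarrow> 0 \<le> v \<alpha> \<and> 0 \<le> v \<beta> \<and>
     0 < v (wa2 e / \<pi> + (2*\<alpha> + \<beta>)) \<and>
     0 < v (wa4 e / \<pi>^2 - (\<alpha>^2 + 2*\<alpha>*\<beta>)) \<and>
     0 < v (wa6 e / \<pi>^3 + \<alpha>^2 * \<beta>)"

text \<open>Normalisation of step 8: triple root of P moved to 0.\<close>
definition tate_N8 :: "('k::field \<Rightarrow> ereal) \<Rightarrow> 'k weq \<Rightarrow> bool" where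
  "tate_N8 v e \<longleftrightarrow> tate_N6 v e \<and> 2 \<le> v (wa2 e) \<and> 3 \<le> v (wa4 e) \<and> 4 \<le> v (wa6 e)"

text \<open>Y^2 + a3/pi^2 Y - a6/pi^4 has a repeated root modulo pi (necessarily rational,
 the residue field being perfect).\<close>
definition tate_Q_repeated :: "('k::field \<Rightarrow> ereal) \<Rightarrow> 'k \<Rightarrow> 'k weq \<Rightarrow> bool" where
  "tate_Q_repeated v \<pi> e \<longleftrightarrow> (\<exists>\<gamma>. 0 \<le> v \<gamma> \<and>
     0 < v (wa3 e / \<pi>^2 + 2*\<gamma>) \<and> 0 < v (- (wa6 e / \<pi>^4) - \<gamma>^2))"

text \<open>The termination conditions of Tate's algorithm (steps 3 to 10), for an integral
 model in the normal form reached at that step, with uniformizer pi.\<close>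
fun tate_ends :: "('k::field \<Rightarrow> ereal) \<Rightarrow> 'k \<Rightarrow> kodaira \<Rightarrow> 'k weq \<Rightarrow> bool" where
  "tate_ends v \<pi> II e \<longleftrightarrow> tate_N2 v e \<and> v (wa6 e) < 2"
| "tate_ends v \<pi> III e \<longleftrightarrow> tate_N2 v e \<and> 2 \<le> v (wa6 e) \<and> v (wb8 e) < 3"
| "tate_ends v \<pi> IV e \<longleftrightarrow> tate_N2 v e \<and> 2 \<le> v (wa6 e) \<and> 3 \<le> v (wb8 e) \<and> v (wb6 e) < 3"
| "tate_ends v \<pi> I0s e \<longleftrightarrow> tate_N6 v e \<and> \<not> (\<exists>\<alpha> \<beta>. tate_P_factor v \<pi> e \<alpha> \<beta>)"
| "tate_ends v \<pi> Ins_pos e \<longleftrightarrow> tate_N6 v e \<and>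
      (\<exists>\<alpha> \<beta>. tate_P_factor v \<pi> e \<alpha> \<beta> \<and> v (\<alpha> - \<beta>) = 0)"
| "tate_ends v \<pi> IVs e \<longleftrightarrow> tate_N8 v e \<and> \<not> tate_Q_repeated v \<pi> e"
| "tate_ends v \<pi> IIIs e \<longleftrightarrow> tate_N8 v e \<and> 3 \<le> v (wa3 e) \<and> 5 \<le> v (wa6 e) \<and> v (wa4 e) < 4"
| "tate_ends v \<pi> IIs e \<longleftrightarrow> tate_N8 v e \<and> 3 \<le> v (wa3 e) \<and> 5 \<le> v (wa6 e) \<and> 4 \<le> v (wa4 e)
      \<and> v (wa6 e) < 6"

text \<open>E (given by e) has Kodaira type T: Tate's algorithm, run on an integral model of E
 (after the coordinate changes it prescribes), stops with output T.\<close>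
definition kodaira_type :: "('k::field \<Rightarrow> ereal) \<Rightarrow> 'k weq \<Rightarrow> kodaira \<Rightarrow> bool" where
  "kodaira_type v e T \<longleftrightarrow>
     (\<exists>\<pi> e'. v \<pi> = 1 \<and> weq_iso e e' \<and> integral_weq v e' \<and> tate_ends v \<pi> T e')"

definition min_ratio :: "('k::field \<Rightarrow> ereal) \<Rightarrow> 'k weq \<Rightarrow> ereal" where
  "min_ratio v e = Min {v (wa1 e) / 1, v (wa2 e) / 2, v (wa3 e) / 3, v (wa4 e) / 4, v (wa6 e) / 6}"

definition cubic_delta :: "'k::comm_ring_1 weq \<Rightarrow> 'k" where
  "cubic_delta e = disc_monic_cubic (wa2 e) (wa4 e) (wa6 e)"

fun paper_cond :: "('k::field \<Rightarrow> ereal) \<Rightarrow> kodaira \<Rightarrow> 'k weq \<Rightarrow> bool" where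
  "paper_cond v II e \<longleftrightarrow> min_ratio v e = 1/6"
| "paper_cond v III e \<longleftrightarrow> min_ratio v e = 1/4"
| "paper_cond v IV e \<longleftrightarrow> min_ratio v e = 1/3 \<and> v (wb6 e) = 2"
| "paper_cond v I0s e \<longleftrightarrow> min_ratio v e = 1/2 \<and> v (cubic_delta e) = 6"
| "paper_cond v Ins_pos e \<longleftrightarrow> min_ratio v e = 1/2 \<and> v (cubic_delta e) > 6
      \<and> v (wa2 e ^ 2 - 3 * wa4 e) = 2"
| "paper_cond v IVs e \<longleftrightarrow> min_ratio v e = 2/3 \<and> v (wb6 e) = 4"
| "paper_cond v IIIs e \<longleftrightarrow> min_ratio v e = 3/4"
| "paper_cond v IIs e \<longleftrightarrow> min_ratio v e = 5/6"

end

theory Submission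
  imports Defs
begin

text \<open>If an integral equation \<open>e\<close> satisfies the condition for a type and its transform by \<open>(u, r, s, t)\<close>
  is integral with \<open>v(u) \<ge> 0\<close>, then \<open>r, s, t\<close> are integral, and the bounds for the \<open>a\<^sub>i\<close> on both
  sides force \<open>r, s, t\<close> into high powers of the maximal ideal.  Therefore, among the equations
  with the relevant bounds on the \<open>a\<^sub>i\<close>, the leading term of the quantity that detects the type
  (\<open>a\<^sub>6\<close>, \<open>a\<^sub>4\<close>, \<open>b\<^sub>6\<close>, the cubic discriminant, \<open>a\<^sub>2\<^sup>2 - 3a\<^sub>4\<close>, \<open>b\<^sub>6\<close>, \<open>a\<^sub>4\<close>, \<open>a\<^sub>6\<close> respectively) does not
  change, and \<open>e\<close> cannot be moved to a model of a later type.  A model with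
  \<open>v(a\<^sub>i) \<ge> i\<close> counts as a last, ninth type, so this yields both minimality and the uniqueness of
  the type.  The normal forms of the algorithm of Tate satisfy the conditions after at most a
  substitution \<open>y \<rightarrow> y + sx\<close>, where \<open>s\<close> is a double root modulo the maximal ideal; repeated roots of
  residual quadratics and cubics are rational because the residue field is perfect.\<close>

section \<open>Lower bounds for valuations\<close>

locale dvf =
  fixes v :: "'k::field \<Rightarrow> ereal"
  assumes dv: "discrete_valuation v" and perfect: "perfect_residue_field v"
begin

text \<open>Integer lower bounds replace values: they hold for \<open>0\<close> without a case
  distinction, and the ring operations propagate them mechanically.\<close>

definition vge :: "int \<Rightarrow> 'k \<Rightarrow> bool" where
  "vge n x \<longleftrightarrow> ereal (of_int n) \<le> v x"

lemma v_mult: "v (x * y) = v x + v y"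
  and v_add: "min (v x) (v y) \<le> v (x + y)"
  and v_inf: "v x = \<infinity> \<longleftrightarrow> x = 0"
  using dv unfolding discrete_valuation_def by blast+

lemma v_int: assumes "x \<noteq> 0" obtains n :: int where "v x = ereal (of_int n)"
  using assms dv unfolding discrete_valuation_def by blast

lemma uniformizer: obtains \<pi> where "v \<pi> = 1" "\<pi> \<noteq> 0"
proof -
  obtain \<pi> where \<pi>: "v \<pi> = 1" using dv unfolding discrete_valuation_def by blast
  with v_inf[of 0] have "\<pi> \<noteq> 0" by auto
  with \<pi> show thesis by (rule that)
qed

lemma vge_0 [simp]: "vge n 0"
  using v_inf[of 0] by (simp add: vge_def)

lemma v_one: "v 1 = 0"
proof -
  obtain n where n: "v 1 = ereal (of_int n)" using v_int[of 1] by auto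
  have "v (1 * 1) = v 1 + v 1" by (rule v_mult)
  thus ?thesis by (simp add: n)
qed

lemma vge_1: "vge 0 1" by (simp add: vge_def v_one)

lemma vge_weaken: "vge i x \<Longrightarrow> n \<le> i \<Longrightarrow> vge n x"
  unfolding vge_def by (meson ereal_less_eq(3) of_int_le_iff order_trans)

lemma vge_mult: "vge i x \<Longrightarrow> vge j y \<Longrightarrow> vge (i + j) (x * y)"
  unfolding vge_def v_mult by (metis add_mono of_int_add plus_ereal.simps(1))

lemma vge_add: "vge i x \<Longrightarrow> vge j y \<Longrightarrow> vge (min i j) (x + y)"
  unfolding vge_def
  by (rule order_trans[OF _ v_add], intro min.boundedI; erule order_trans[rotated]; simp)

lemma vge_power: "vge i x \<Longrightarrow> vge (int k * i) (x ^ k)"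
proof (induction k)
  case 0 thus ?case by (simp add: vge_1)
next
  case (Suc k)
  then have "vge (i + int k * i) (x * x ^ k)" by (intro vge_mult) auto
  then show ?case by (simp add: algebra_simps)
qed

lemma vge_neg_one: "vge 0 (-1)"
proof (rule ccontr)
  assume *: "\<not> vge 0 (-1)"
  obtain n where n: "v (-1) = ereal (of_int n)" using v_int[of "-1"] by auto
  have "v ((-1)*(-1)) = v (-1) + v (-1)" by (rule v_mult)
  with n v_one have "n = 0" by simp
  with n * show False by (simp add: vge_def)
qed

lemma vge_minus: "vge i x \<Longrightarrow> vge i (- x)"
  using vge_mult[OF vge_neg_one, of i x] by simp

lemma vge_diff: "vge i x \<Longrightarrow> vge j y \<Longrightarrow> vge (min i j) (x - y)"
  using vge_add[OF _ vge_minus, of i x j y] by simp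

lemma vge_of_nat: "vge 0 (of_nat n)"
proof (induction n)
  case (Suc n)
  then have "vge (min 0 0) (1 + of_nat n)" using vge_1 by (rule_tac vge_add) auto
  then show ?case by simp
qed simp

lemma vge_numeral: "vge 0 (numeral w)"
  using vge_of_nat[of "numeral w"] by simp

text \<open>Used as \<open>(rule vge_weaken, (rule facts vge_calc)+, simp)\<close>: the rules compute a lower bound for the
  valuation of a polynomial expression by recursion on its syntax, starting from the bounds
  for its variables in \<open>facts\<close>.\<close>
lemmas vge_calc = vge_mult vge_add vge_diff vge_minus vge_power vge_1 vge_numeral

lemma vge_mult_iff:
  assumes "v x = ereal (of_int n)"
  shows "vge (m + n) (x * y) \<longleftrightarrow> vge m y"
  unfolding vge_def v_mult assms by (cases "v y") auto

text \<open>Values on nonzero elements are integers, so no value lies strictly between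
  \<open>n\<close> and \<open>n + 1\<close>.\<close>

lemma v_eq_vge: "v x = ereal (of_int n) \<longleftrightarrow> vge n x \<and> \<not> vge (n + 1) x"
proof (cases "x = 0")
  case True thus ?thesis using v_inf[of 0] by simp
next
  case False
  then obtain m where "v x = ereal (of_int m)" by (rule v_int)
  thus ?thesis by (auto simp: vge_def)
qed

text \<open>The valuation of a square is even, so an odd bound \<open>2 * k - 1\<close> rounds up to
  \<open>2 * k\<close>. This rounding, like the one for cubes below, is what improves the bounds on
  \<open>r\<close>, \<open>s\<close> and \<open>t\<close>.\<close>

lemma vge_square: assumes "vge (2 * k - 1) (x ^ 2)" shows "vge k x"
proof (cases "x = 0")
  case False
  then obtain m where m: "v x = ereal (of_int m)" by (rule v_int)
  have "2 * k - 1 \<le> 2 * m"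
    using assms unfolding vge_def power2_eq_square v_mult m by (simp flip: of_int_add)
  thus ?thesis unfolding vge_def m by simp
qed simp

lemma vge_cube: assumes "vge (3 * k - 2) (x ^ 3)" shows "vge k x"
proof (cases "x = 0")
  case False
  then obtain m where m: "v x = ereal (of_int m)" by (rule v_int)
  have "3 * k - 2 \<le> 3 * m"
    using assms unfolding vge_def power3_eq_cube v_mult m by (simp flip: of_int_add)
  thus ?thesis unfolding vge_def m by simp
qed simp

lemma vge_unit_inverse: assumes "vge 0 x" "\<not> vge 1 x" shows "vge 0 (1 / x)" "x \<noteq> 0"
proof -
  show x: "x \<noteq> 0" using assms by auto
  have "v x = ereal (of_int 0)" using assms by (subst v_eq_vge) simp
  with vge_mult_iff[OF this, of 0 "1 / x"] x show "vge 0 (1 / x)" by (simp add: vge_1)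
qed

lemma vge_literal_iff: "1 \<le> v x \<longleftrightarrow> vge 1 x" "0 \<le> v x \<longleftrightarrow> vge 0 x"
    "numeral w \<le> v x \<longleftrightarrow> vge (numeral w) x" "v x < numeral w \<longleftrightarrow> \<not> vge (numeral w) x"
  by (auto simp: vge_def one_ereal_def zero_ereal_def)

lemma v_eq_numeral: "v x = numeral w \<longleftrightarrow> vge (numeral w) x \<and> \<not> vge (numeral w + 1) x"
  using v_eq_vge[of x "numeral w"] by simp

lemma v_eq_0: "v x = 0 \<longleftrightarrow> vge 0 x \<and> \<not> vge 1 x"
  using v_eq_vge[of x 0] by (simp add: zero_ereal_def)

lemma ereal_less_v: "ereal (of_int n) < v x \<longleftrightarrow> vge (n + 1) x"
proof (cases "x = 0")
  case False
  then obtain m where "v x = ereal (of_int m)" by (rule v_int)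
  thus ?thesis by (auto simp: vge_def)
qed (use v_inf[of 0] in simp)

lemma v_pos_iff: "0 < v x \<longleftrightarrow> vge 1 x" and numeral_less_v: "numeral w < v x \<longleftrightarrow> vge (numeral w + 1) x"
  using ereal_less_v[of 0 x] ereal_less_v[of "numeral w" x] by (simp_all add: zero_ereal_def)

lemmas v_to_vge = vge_literal_iff v_eq_numeral v_eq_0 v_pos_iff numeral_less_v

section \<open>The minimum of the v(a_i)/i in terms of integer bounds\<close>

text \<open>The hypotheses say that \<open>n\<close> is the ceiling of \<open>c * k\<close>.\<close>

lemma ratio_ge: fixes c k :: real assumes "k > 0" "of_int n - 1 < c * k" "c * k \<le> of_int n"
  shows "ereal c \<le> v x / ereal k \<longleftrightarrow> vge n x"
proof (cases "x = 0")
  case True thus ?thesis using v_inf[of 0] assms by simp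
next
  case False
  then obtain m where m: "v x = ereal (of_int m)" by (rule v_int)
  have "c \<le> of_int m / k \<longleftrightarrow> c * k \<le> of_int m" using assms by (simp add: field_simps)
  also have "\<dots> \<longleftrightarrow> n \<le> m" using assms by linarith
  finally show ?thesis using assms by (simp add: vge_def m)
qed

text \<open>For the strict inequality \<open>n\<close> is the floor of \<open>c * k\<close> plus
  one, so the weak and strict signs in the hypotheses change places.\<close>

lemma ratio_gt: fixes c k :: real assumes "k > 0" "of_int n - 1 \<le> c * k" "c * k < of_int n"
  shows "ereal c < v x / ereal k \<longleftrightarrow> vge n x"
proof (cases "x = 0")
  case True thus ?thesis using v_inf[of 0] assms by simp
next
  case False
  then obtain m where m: "v x = ereal (of_int m)" by (rule v_int)
  have "c < of_int m / k \<longleftrightarrow> c * k < of_int m" using assms by (simp add: field_simps)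
  also have "\<dots> \<longleftrightarrow> n \<le> m" using assms by linarith
  finally show ?thesis using assms by (simp add: vge_def m)
qed

definition coeffs_vge :: "'k weq \<Rightarrow> int \<Rightarrow> int \<Rightarrow> int \<Rightarrow> int \<Rightarrow> int \<Rightarrow> bool" where
  "coeffs_vge e n1 n2 n3 n4 n6 \<longleftrightarrow>
     vge n1 (wa1 e) \<and> vge n2 (wa2 e) \<and> vge n3 (wa3 e) \<and> vge n4 (wa4 e) \<and> vge n6 (wa6 e)"

lemma min_ratio_ge:
  assumes "of_int n1 - 1 < c * 1" "c * 1 \<le> of_int n1" "of_int n2 - 1 < c * 2" "c * 2 \<le> of_int n2"
    "of_int n3 - 1 < c * 3" "c * 3 \<le> of_int n3" "of_int n4 - 1 < c * 4" "c * 4 \<le> of_int n4"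
    "of_int n6 - 1 < c * 6" "c * 6 \<le> of_int n6"
  shows "ereal c \<le> min_ratio v e \<longleftrightarrow> coeffs_vge e n1 n2 n3 n4 n6"
proof -
  have "ereal c \<le> v (wa1 e) / ereal 1 \<longleftrightarrow> vge n1 (wa1 e)"
    "ereal c \<le> v (wa2 e) / ereal 2 \<longleftrightarrow> vge n2 (wa2 e)"
    "ereal c \<le> v (wa3 e) / ereal 3 \<longleftrightarrow> vge n3 (wa3 e)"
    "ereal c \<le> v (wa4 e) / ereal 4 \<longleftrightarrow> vge n4 (wa4 e)"
    "ereal c \<le> v (wa6 e) / ereal 6 \<longleftrightarrow> vge n6 (wa6 e)"
    by (rule ratio_ge, (rule assms zero_less_one zero_less_numeral)+)+
  then show ?thesis
    by (simp only: min_ratio_def coeffs_vge_def one_ereal_def numeral_eq_ereal Min_ge_iff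
        finite.intros insert_not_empty ball_simps simp_thms)
qed

lemma min_ratio_gt:
  assumes "of_int n1 - 1 \<le> c * 1" "c * 1 < of_int n1" "of_int n2 - 1 \<le> c * 2" "c * 2 < of_int n2"
    "of_int n3 - 1 \<le> c * 3" "c * 3 < of_int n3" "of_int n4 - 1 \<le> c * 4" "c * 4 < of_int n4"
    "of_int n6 - 1 \<le> c * 6" "c * 6 < of_int n6"
  shows "ereal c < min_ratio v e \<longleftrightarrow> coeffs_vge e n1 n2 n3 n4 n6"
proof -
  have "ereal c < v (wa1 e) / ereal 1 \<longleftrightarrow> vge n1 (wa1 e)"
    "ereal c < v (wa2 e) / ereal 2 \<longleftrightarrow> vge n2 (wa2 e)"
    "ereal c < v (wa3 e) / ereal 3 \<longleftrightarrow> vge n3 (wa3 e)"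
    "ereal c < v (wa4 e) / ereal 4 \<longleftrightarrow> vge n4 (wa4 e)"
    "ereal c < v (wa6 e) / ereal 6 \<longleftrightarrow> vge n6 (wa6 e)"
    by (rule ratio_gt, (rule assms zero_less_one zero_less_numeral)+)+
  then show ?thesis
    by (simp only: min_ratio_def coeffs_vge_def one_ereal_def numeral_eq_ereal Min_gr_iff
        finite.intros insert_not_empty ball_simps simp_thms)
qed

text \<open>The vector negated on each line is the vector required on the next: integer valuations
  admit no value of the minimum strictly between consecutive listed ones.\<close>

lemma min_ratio_eq:
  "min_ratio v e = 1/6 \<longleftrightarrow> coeffs_vge e 1 1 1 1 1 \<and> \<not> coeffs_vge e 1 1 1 1 2"
  "min_ratio v e = 1/4 \<longleftrightarrow> coeffs_vge e 1 1 1 1 2 \<and> \<not> coeffs_vge e 1 1 1 2 2"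
  "min_ratio v e = 1/3 \<longleftrightarrow> coeffs_vge e 1 1 1 2 2 \<and> \<not> coeffs_vge e 1 1 2 2 3"
  "min_ratio v e = 1/2 \<longleftrightarrow> coeffs_vge e 1 1 2 2 3 \<and> \<not> coeffs_vge e 1 2 2 3 4"
  "min_ratio v e = 2/3 \<longleftrightarrow> coeffs_vge e 1 2 2 3 4 \<and> \<not> coeffs_vge e 1 2 3 3 5"
  "min_ratio v e = 3/4 \<longleftrightarrow> coeffs_vge e 1 2 3 3 5 \<and> \<not> coeffs_vge e 1 2 3 4 5"
  "min_ratio v e = 5/6 \<longleftrightarrow> coeffs_vge e 1 2 3 4 5 \<and> \<not> coeffs_vge e 1 2 3 4 6"
proof -
  have eq: "x = c \<longleftrightarrow> c \<le> x \<and> \<not> c < x" for x c :: ereal by auto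
  have c: "1/6 = ereal (1/6)" "1/4 = ereal (1/4)" "1/3 = ereal (1/3)" "1/2 = ereal (1/2)"
    "2/3 = ereal (2/3)" "3/4 = ereal (3/4)" "5/6 = ereal (5/6)"
    by (simp_all add: one_ereal_def)
  have "ereal (1/6) \<le> min_ratio v e \<longleftrightarrow> coeffs_vge e 1 1 1 1 1"
    by (rule min_ratio_ge) simp_all
  moreover have "ereal (1/6) < min_ratio v e \<longleftrightarrow> coeffs_vge e 1 1 1 1 2"
    by (rule min_ratio_gt) simp_all
  ultimately show "min_ratio v e = 1/6 \<longleftrightarrow> coeffs_vge e 1 1 1 1 1 \<and> \<not> coeffs_vge e 1 1 1 1 2"
    unfolding c eq by blast
  have "ereal (1/4) \<le> min_ratio v e \<longleftrightarrow> coeffs_vge e 1 1 1 1 2"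
    by (rule min_ratio_ge) simp_all
  moreover have "ereal (1/4) < min_ratio v e \<longleftrightarrow> coeffs_vge e 1 1 1 2 2"
    by (rule min_ratio_gt) simp_all
  ultimately show "min_ratio v e = 1/4 \<longleftrightarrow> coeffs_vge e 1 1 1 1 2 \<and> \<not> coeffs_vge e 1 1 1 2 2"
    unfolding c eq by blast
  have "ereal (1/3) \<le> min_ratio v e \<longleftrightarrow> coeffs_vge e 1 1 1 2 2"
    by (rule min_ratio_ge) simp_all
  moreover have "ereal (1/3) < min_ratio v e \<longleftrightarrow> coeffs_vge e 1 1 2 2 3"
    by (rule min_ratio_gt) simp_all
  ultimately show "min_ratio v e = 1/3 \<longleftrightarrow> coeffs_vge e 1 1 1 2 2 \<and> \<not> coeffs_vge e 1 1 2 2 3"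
    unfolding c eq by blast
  have "ereal (1/2) \<le> min_ratio v e \<longleftrightarrow> coeffs_vge e 1 1 2 2 3"
    by (rule min_ratio_ge) simp_all
  moreover have "ereal (1/2) < min_ratio v e \<longleftrightarrow> coeffs_vge e 1 2 2 3 4"
    by (rule min_ratio_gt) simp_all
  ultimately show "min_ratio v e = 1/2 \<longleftrightarrow> coeffs_vge e 1 1 2 2 3 \<and> \<not> coeffs_vge e 1 2 2 3 4"
    unfolding c eq by blast
  have "ereal (2/3) \<le> min_ratio v e \<longleftrightarrow> coeffs_vge e 1 2 2 3 4"
    by (rule min_ratio_ge) simp_all
  moreover have "ereal (2/3) < min_ratio v e \<longleftrightarrow> coeffs_vge e 1 2 3 3 5"
    by (rule min_ratio_gt) simp_all
  ultimately show "min_ratio v e = 2/3 \<longleftrightarrow> coeffs_vge e 1 2 2 3 4 \<and> \<not> coeffs_vge e 1 2 3 3 5"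
    unfolding c eq by blast
  have "ereal (3/4) \<le> min_ratio v e \<longleftrightarrow> coeffs_vge e 1 2 3 3 5"
    by (rule min_ratio_ge) simp_all
  moreover have "ereal (3/4) < min_ratio v e \<longleftrightarrow> coeffs_vge e 1 2 3 4 5"
    by (rule min_ratio_gt) simp_all
  ultimately show "min_ratio v e = 3/4 \<longleftrightarrow> coeffs_vge e 1 2 3 3 5 \<and> \<not> coeffs_vge e 1 2 3 4 5"
    unfolding c eq by blast
  have "ereal (5/6) \<le> min_ratio v e \<longleftrightarrow> coeffs_vge e 1 2 3 4 5"
    by (rule min_ratio_ge) simp_all
  moreover have "ereal (5/6) < min_ratio v e \<longleftrightarrow> coeffs_vge e 1 2 3 4 6"
    by (rule min_ratio_gt) simp_all
  ultimately show "min_ratio v e = 5/6 \<longleftrightarrow> coeffs_vge e 1 2 3 4 5 \<and> \<not> coeffs_vge e 1 2 3 4 6"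
    unfolding c eq by blast
qed

end

section \<open>Shifts between models with positive coefficients\<close>

text \<open>The substitution x -> x + r translates all roots of the cubic and keeps their
  differences.\<close>

lemma cubic_disc_shift:
  fixes a b c r :: "'a::comm_ring_1"
  shows "disc_monic_cubic (a + 3 * r) (b + 2 * r * a + 3 * r^2) (c + r * b + r^2 * a + r^3)
    = disc_monic_cubic a b c"
  unfolding disc_monic_cubic_def by (simp add: algebra_simps power_numeral_reduce)

context dvf
begin

text \<open>Congruence in the \<open>i\<close>-th graded piece of the filtration by powers of the maximal ideal.\<close>
definition vcong :: "int \<Rightarrow> 'k \<Rightarrow> 'k \<Rightarrow> bool" where
  "vcong i x y \<longleftrightarrow> vge i x \<and> vge i y \<and> vge (i + 1) (x - y)"

lemma vcong_mult: assumes "vcong i x y" "vcong j z w" shows "vcong (i + j) (x * z) (y * w)"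
proof -
  have "x * z - y * w = (x - y) * z + y * (z - w)" by (simp add: algebra_simps)
  moreover have "vge (min (i + 1 + j) (i + (j + 1))) ((x - y) * z + y * (z - w))"
    using assms unfolding vcong_def by (intro vge_add vge_mult) auto
  ultimately show ?thesis using assms unfolding vcong_def by (auto intro: vge_mult vge_weaken)
qed

lemma vcong_numeral: "vcong 0 (numeral w) (numeral w)" and vcong_1: "vcong 0 1 1"
  by (simp_all add: vcong_def vge_numeral vge_1)

lemma vcong_power: "vcong i x y \<Longrightarrow> vcong (int k * i) (x ^ k) (y ^ k)"
proof (induction k)
  case 0 thus ?case by (simp add: vcong_1)
next
  case (Suc k)
  then have "vcong (i + int k * i) (x * x ^ k) (y * y ^ k)" by (intro vcong_mult) auto
  then show ?case by (simp add: algebra_simps)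
qed

lemma vcong_minus: "vcong i x y \<Longrightarrow> vcong i (- x) (- y)"
  unfolding vcong_def by (metis vge_minus minus_diff_eq minus_diff_minus)

lemma vcong_add: assumes "vcong i x y" "vcong j z w" "i = j" shows "vcong i (x + z) (y + w)"
proof -
  have "vge (i + 1) ((x - y) + (z - w))"
    using assms vge_add[of "i + 1" "x - y" "i + 1" "z - w"] unfolding vcong_def by simp
  also have "(x - y) + (z - w) = x + z - (y + w)" by simp
  finally show ?thesis
    using assms vge_add[of i x i z] vge_add[of i y i w] unfolding vcong_def by simp
qed

lemma vcong_diff: "vcong i x y \<Longrightarrow> vcong j z w \<Longrightarrow> i = j \<Longrightarrow> vcong i (x - z) (y - w)"
  using vcong_add[OF _ vcong_minus, of i x y j z w] by simp

lemmas vcong_calc = vcong_mult vcong_add vcong_diff vcong_minus vcong_power vcong_1 vcong_numeral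

text \<open>Elements with the same leading term have vanishing leading term simultaneously.\<close>

lemma vcong_vge_iff: assumes "vcong i x y" shows "vge (i + 1) x \<longleftrightarrow> vge (i + 1) y"
proof -
  have "x = y + (x - y)" "y = x - (x - y)" by simp_all
  then show ?thesis using assms vge_add[of "i+1" y "i+1" "x - y"] vge_diff[of "i+1" x "i+1" "x - y"]
    unfolding vcong_def by auto
qed

text \<open>The discriminant is isobaric of weight 6 when \<open>a\<close>, \<open>b\<close>,
  \<open>c\<close> have weights 1, 2, 3.\<close>

lemma vcong_disc:
  assumes "vcong n a a'" "vcong (2 * n) b b'" "vcong (3 * n) c c'"
  shows "vcong (6 * n) (disc_monic_cubic a b c) (disc_monic_cubic a' b' c')"
proof -
  have "vcong (int 2 * n + int 2 * (2 * n)) (disc_monic_cubic a b c) (disc_monic_cubic a' b' c')"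
    \<comment> \<open>The weight has to be written in the form computed for the first monomial \<open>a\<^sup>2 b\<^sup>2\<close>.\<close>
    unfolding disc_monic_cubic_def by (rule assms vcong_calc | simp)+
  then show ?thesis by simp
qed

end

text \<open>The \<open>c1\<close>, ..., \<open>c6\<close> are the coefficients after the
  substitution with \<open>u = 1\<close>. Both equations reduce to the cusp y^2 = x^3 with its
  singular point at the origin.\<close>

locale dvf_shift = dvf v for v :: "'k::field \<Rightarrow> ereal" +
  fixes a1 a2 a3 a4 a6 c1 c2 c3 c4 c6 r s t :: 'k
  assumes c1: "c1 = a1 + 2*s"
    and c2: "c2 = a2 - s*a1 + 3*r - s^2"
    and c3: "c3 = a3 + r*a1 + 2*t"
    and c4: "c4 = a4 - s*a3 + 2*r*a2 - (t + r*s)*a1 + 3*r^2 - 2*s*t"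
    and c6: "c6 = a6 + r*a4 + r^2*a2 + r^3 - t*a3 - t^2 - r*t*a1"
    and a_pos: "vge 1 a1" "vge 1 a2" "vge 1 a3" "vge 1 a4" "vge 1 a6"
    and c_pos: "vge 1 c1" "vge 1 c2" "vge 1 c3" "vge 1 c4" "vge 1 c6"
    and rst: "vge 0 r" "vge 0 s" "vge 0 t"
begin

lemma r_pos: "vge 1 r"
proof (rule vge_cube)
  \<comment> \<open>The equations for \<open>c\<^sub>3\<close>, \<open>c\<^sub>4\<close>, \<open>c\<^sub>6\<close> put \<open>2t\<close>, \<open>3r\<^sup>2 - 2st\<close> and \<open>r\<^sup>3 - t\<^sup>2\<close> in the maximal ideal,
    and \<open>r\<^sup>3 = 4(r\<^sup>3 - t\<^sup>2) + (2t)\<^sup>2 - r(3r\<^sup>2 - 2st) - rs(2t)\<close>; no case split on the residue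
    characteristic is needed.\<close>
  have "r^3 = 4 * (c6 - a6 - r*a4 - r^2*a2 + t*a3 + r*t*a1) + (c3 - a3 - r*a1)^2
      - r * (c4 - a4 + s*a3 - 2*r*a2 + (t + r*s)*a1) - r*s*(c3 - a3 - r*a1)"
    unfolding c3 c4 c6 by algebra
  also have "vge (3 * 1 - 2) \<dots>" by (rule vge_weaken, (rule a_pos c_pos rst vge_calc)+, simp)
  finally show "vge (3 * 1 - 2) (r ^ 3)" .
qed

text \<open>Once \<open>r\<close> is in the maximal ideal, the equation for \<open>c2\<close> leaves
  only \<open>s^2\<close>; in the same way the one for \<open>c6\<close> later leaves only
  \<open>t^2\<close>.\<close>

lemma s_pos: "vge 1 s"
proof (rule vge_square)
  have "s^2 = a2 - s*a1 + 3*r - c2" unfolding c2 by algebra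
  also have "vge (2 * 1 - 1) \<dots>" by (rule vge_weaken, (rule a_pos c_pos r_pos rst vge_calc)+, simp)
  finally show "vge (2 * 1 - 1) (s ^ 2)" .
qed

lemma t_square: "t^2 = a6 + r*a4 + r^2*a2 + r^3 - t*a3 - r*t*a1 - c6"
  unfolding c6 by algebra

lemma t_pos: "vge 1 t"
proof (rule vge_square)
  have "vge (2 * 1 - 1) (a6 + r*a4 + r^2*a2 + r^3 - t*a3 - r*t*a1 - c6)"
    by (rule vge_weaken, (rule a_pos c_pos r_pos rst vge_calc)+, simp)
  then show "vge (2 * 1 - 1) (t ^ 2)" unfolding t_square .
qed

lemmas pos = a_pos c_pos r_pos s_pos t_pos

lemma a4_eq: "a4 = c4 + s*a3 - 2*r*a2 + (t + r*s)*a1 - 3*r^2 + 2*s*t"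
  unfolding c4 by algebra

lemma a6_eq: "a6 = c6 - r*a4 - r^2*a2 - r^3 + t*a3 + t^2 + r*t*a1"
  unfolding c6 by algebra

text \<open>Completing the square in y removes \<open>s\<close> and \<open>t\<close>, so weak bounds
  on \<open>t\<close> do no harm here.\<close>

lemma b6_eq:
  "a3^2 + 4*a6 = c3^2 + 4*c6 - 2*r*(2*a4 + a1*a3) - r^2*(a1^2 + 4*a2) - 4*r^3"
  unfolding c3 c6 by algebra

text \<open>Apart from \<open>c6\<close>, every term of \<open>a6_eq\<close> contains at least two
  factors from the maximal ideal; the same holds for \<open>a4_eq\<close> in the next lemma.\<close>

lemma pass_II: assumes "vge 2 c6" shows "vge 2 a6"
  by (subst a6_eq, rule vge_weaken, (rule assms pos vge_calc)+, simp)

lemma pass_III: assumes "vge 2 c4" shows "vge 2 a4"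
  by (subst a4_eq, rule vge_weaken, (rule assms pos vge_calc)+, simp)

lemma pass_IV:
  assumes "vge 2 a4" "vge 2 c3" "vge 3 c6"
  shows "vge 3 (a3^2 + 4*a6)"
  by (subst b6_eq, rule vge_weaken, (rule assms pos vge_calc)+, simp)

lemma t_2:
  assumes "vge 2 a3" "vge 2 a4" "vge 3 a6" "vge 3 c6"
  shows "vge 2 t"
proof (rule vge_square)
  show "vge (2 * 2 - 1) (t ^ 2)"
    by (subst t_square, rule vge_weaken, (rule assms pos vge_calc)+, simp)
qed

context
  assumes a_lev: "vge 2 a3" "vge 2 a4" "vge 3 a6" and c_lev: "vge 2 c4" "vge 3 c6"
begin

text \<open>As \<open>t\<close> has valuation at least 2, all terms containing \<open>s\<close> or
  \<open>t\<close> are of higher order. To leading order only the translation of the cubic by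
  \<open>r\<close> remains.\<close>

lemma cubic_shift_vcong:
  "vcong 1 c2 (a2 + 3*r)" "vcong 2 c4 (a4 + 2*r*a2 + 3*r^2)" "vcong 3 c6 (a6 + r*a4 + r^2*a2 + r^3)"
proof -
  note t2 = t_2[OF a_lev c_lev(2)]
  have "vge 2 (- (s*a1) - s^2)" "vge 3 (- (s*a3) - (t + r*s)*a1 - 2*s*t)"
    "vge 4 (- (t*a3) - t^2 - r*t*a1)"
    by (rule vge_weaken, (rule a_lev t2 pos vge_calc)+, simp)+
  moreover have "c2 - (a2 + 3*r) = - (s*a1) - s^2"
    "c4 - (a4 + 2*r*a2 + 3*r^2) = - (s*a3) - (t + r*s)*a1 - 2*s*t"
    "c6 - (a6 + r*a4 + r^2*a2 + r^3) = - (t*a3) - t^2 - r*t*a1"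
    unfolding c2 c4 c6 by algebra+
  moreover have "vge 1 (a2 + 3*r)" "vge 2 (a4 + 2*r*a2 + 3*r^2)" "vge 3 (a6 + r*a4 + r^2*a2 + r^3)"
    by (rule vge_weaken, (rule a_lev t2 pos vge_calc)+, simp)+
  ultimately show "vcong 1 c2 (a2 + 3*r)" "vcong 2 c4 (a4 + 2*r*a2 + 3*r^2)"
    "vcong 3 c6 (a6 + r*a4 + r^2*a2 + r^3)"
    using c_lev c_pos unfolding vcong_def by simp_all
qed

lemma pass_I0s: "vge 7 (disc_monic_cubic c2 c4 c6) \<longleftrightarrow> vge 7 (disc_monic_cubic a2 a4 a6)"
  using vcong_disc[of 1, OF cubic_shift_vcong(1)] cubic_shift_vcong(2,3) vcong_vge_iff[of 6]
  by (fastforce simp: cubic_disc_shift)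

text \<open>Like the discriminant, a^2 - 3b is unchanged when the cubic x^3 + a x^2 + b x + c is
  translated.\<close>

lemma pass_Ins: "vge 3 (c2^2 - 3*c4) \<longleftrightarrow> vge 3 (a2^2 - 3*a4)"
proof -
  have "vcong (int 2 * 1) (c2^2 - 3*c4) ((a2 + 3*r)^2 - 3*(a4 + 2*r*a2 + 3*r^2))"
    by (rule cubic_shift_vcong vcong_calc | simp)+
  also have "(a2 + 3*r)^2 - 3*(a4 + 2*r*a2 + 3*r^2) = a2^2 - 3*a4" by algebra
  finally show ?thesis using vcong_vge_iff[of 2] by fastforce
qed

end

text \<open>The bound on \<open>t\<close> comes first, since it gives \<open>t^2\<close> valuation
  4; then \<open>r^3\<close> has valuation at least 4 and rounding gives the claim.\<close>

lemma r_2: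
  assumes "vge 2 a2" "vge 2 a3" "vge 3 a4" "vge 4 a6" "vge 4 c6"
  shows "vge 2 r"
proof (rule vge_cube)
  have t2: "vge 2 t" using assms by (intro t_2) (auto intro: vge_weaken)
  have "r^3 = c6 - a6 - r*a4 - r^2*a2 + t*a3 + t^2 + r*t*a1" unfolding c6 by algebra
  also have "vge (3 * 2 - 2) \<dots>" by (rule vge_weaken, (rule t2 assms pos vge_calc)+, simp)
  finally show "vge (3 * 2 - 2) (r ^ 3)" .
qed

lemma pass_IVs:
  assumes "vge 2 a2" "vge 2 a3" "vge 3 a4" "vge 4 a6" "vge 3 c3" "vge 5 c6"
  shows "vge 5 (a3^2 + 4*a6)"
proof -
  have r2: "vge 2 r" using assms by (intro r_2) (auto intro: vge_weaken)
  show ?thesis by (subst b6_eq, rule vge_weaken, (rule r2 assms pos vge_calc)+, simp)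
qed

context
  assumes a_lev: "vge 2 a2" "vge 3 a3" "vge 3 a4" "vge 5 a6" and c_lev: "vge 5 c6"
begin

lemma r_2': "vge 2 r"
  using a_lev c_lev by (intro r_2) (auto intro: vge_weaken)

lemma t_3: "vge 3 t"
proof (rule vge_square)
  have t2: "vge 2 t" using a_lev c_lev by (intro t_2) (auto intro: vge_weaken)
  show "vge (2 * 3 - 1) (t ^ 2)"
    by (subst t_square, rule vge_weaken, (rule a_lev c_lev r_2' t2 pos vge_calc)+, simp)
qed

lemma pass_IIIs: assumes "vge 4 c4" shows "vge 4 a4"
  by (subst a4_eq, rule vge_weaken, (rule assms r_2' t_3 a_lev pos vge_calc)+, simp)

lemma pass_IIs: assumes "vge 4 a4" "vge 6 c6" shows "vge 6 a6"
  by (subst a6_eq, rule vge_weaken, (rule assms r_2' t_3 a_lev pos vge_calc)+, simp)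

end

end

section \<open>Repeated roots over the residue field\<close>

context dvf
begin

lemma residue_root:
  assumes "prime p" "vge 1 (of_nat p)" "vge 0 x"
  obtains y where "vge 0 y" "vge 1 (y ^ p - x)"
  using assms perfect unfolding perfect_residue_field_def v_to_vge by blast

text \<open>The polynomial is T^2 + pT - q with discriminant p^2 + 4q. In residue characteristic 2
  this forces \<open>p\<close> into the maximal ideal, and perfectness supplies a square root of
  \<open>q\<close>; otherwise the root is -p/2.\<close>

lemma double_root:
  assumes "vge 0 p" "vge 0 q" "vge 1 (p^2 + 4*q)"
  obtains s where "vge 0 s" "vge 1 (2*s + p)" "vge 1 (s^2 + p*s - q)"
proof (cases "vge 1 2")
  case True
  then obtain s where s: "vge 0 s" "vge 1 (s^2 - q)"
    using residue_root[of 2 q] assms by auto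
  have p: "vge 1 p"
  proof (rule vge_square)
    have "p^2 = (p^2 + 4*q) - 2*(2*q)" by simp
    also have "vge (2 * 1 - 1) \<dots>" by (rule vge_weaken, (rule assms True vge_calc)+, simp)
    finally show "vge (2 * 1 - 1) (p^2)" .
  qed
  have "vge 1 (2*s + p)" "vge 1 (p*s + (s^2 - q))"
    by (rule vge_weaken, (rule p s True vge_calc)+, simp)+
  with s show thesis by (intro that) (simp_all add: algebra_simps)
next
  case False
  from vge_unit_inverse[OF vge_numeral this] obtain h where h: "vge 0 h" "2 * h = 1"
    by (metis nonzero_mult_divide_mult_cancel_left2 div_by_1 mult.right_neutral times_divide_eq_right divide_self)
  show thesis
  proof
    show "vge 0 (- p*h)" by (rule vge_weaken, (rule assms h vge_calc)+, simp)
    have "2*(- p*h) + p = 0" using h(2) by algebra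
    then show "vge 1 (2*(- p*h) + p)" by (simp only: vge_0)
    have "(- p*h)^2 + p*(- p*h) - q = - (h^2*(p^2 + 4*q))" using h(2) by algebra
    also have "vge 1 \<dots>" by (rule vge_weaken, (rule assms h vge_calc)+, simp)
    finally show "vge 1 ((- p*h)^2 + p*(- p*h) - q)" .
  qed
qed

text \<open>For (T - \<alpha>)^2 (T - \<beta>) the quantity A^2 - 3B equals (\<alpha> - \<beta>)^2,
  so this is the case of a root that is exactly double. In residue characteristic 2 the discriminant
  is (C - AB)^2; hence the cubic is (T + A)(T^2 + B), and a square root of \<open>B\<close> is the
  double root.\<close>

lemma repeated_root_unit:
  assumes ABC: "vge 0 A" "vge 0 B" "vge 0 C" and disc: "vge 1 (disc_monic_cubic A B C)"
    and unit: "\<not> vge 1 (A^2 - 3*B)"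
  shows "\<exists>\<alpha> \<beta>. vge 0 \<alpha> \<and> vge 0 \<beta> \<and> vge 1 (A + (2*\<alpha> + \<beta>)) \<and> vge 1 (B - (\<alpha>^2 + 2*\<alpha>*\<beta>)) \<and> vge 1 (C + \<alpha>^2*\<beta>)"
proof (cases "vge 1 2")
  case True
  then obtain \<alpha> where \<alpha>: "vge 0 \<alpha>" "vge 1 (\<alpha>^2 - B)"
    using residue_root[of 2 B] ABC by auto
  have CAB: "vge 1 (C - A*B)"
  proof (rule vge_square)
    have "(C - A*B)^2 = disc_monic_cubic A B C + 2*(14*C^2 - 10*A*B*C + 2*B^3 + 2*A^3*C)"
      unfolding disc_monic_cubic_def by algebra
    also have "vge (2 * 1 - 1) \<dots>" by (rule vge_weaken, (rule disc ABC True vge_calc)+, simp)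
    finally show "vge (2 * 1 - 1) ((C - A*B)^2)" .
  qed
  have "vge 1 (2*\<alpha>)" "vge 1 (2*(\<alpha>*A) - (\<alpha>^2 - B))" "vge 1 ((C - A*B) - A*(\<alpha>^2 - B))" "vge 0 (- A)"
    by (rule vge_weaken, (rule \<alpha>(2) CAB True \<alpha>(1) ABC vge_calc)+, simp)+
  moreover have "2*\<alpha> = A + (2*\<alpha> + - A)" "2*(\<alpha>*A) - (\<alpha>^2 - B) = B - (\<alpha>^2 + 2*\<alpha>*(- A))"
    "(C - A*B) - A*(\<alpha>^2 - B) = C + \<alpha>^2 * (- A)"
    by (simp_all add: algebra_simps)
  ultimately show ?thesis using \<alpha>(1) by metis
next
  case False
  define \<Delta> where "\<Delta> = A^2 - 3*B"
  have "vge 0 \<Delta>" unfolding \<Delta>_def by (rule vge_weaken, (rule ABC vge_calc)+, simp)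
  with unit have "vge 0 (1 / \<Delta>)" "\<Delta> \<noteq> 0" using vge_unit_inverse unfolding \<Delta>_def by blast+
  moreover have "vge 0 (1 / 2)" "(2::'k) \<noteq> 0" using vge_unit_inverse[OF vge_numeral False] by auto
  ultimately obtain h where h: "vge 0 h" "2 * \<Delta> * h = 1"
    using vge_mult[of 0 "1/2" 0 "1/\<Delta>"] by (intro that[of "1/2 * (1/\<Delta>)"]) auto
  define N where "N = 9*C - A*B"
  define \<alpha> where "\<alpha> = N*h"
    \<comment> \<open>the double root \<open>(9C - AB) / (2(A\<^sup>2 - 3B))\<close> of a cubic with vanishing discriminant\<close>
  have "B + 2*A*\<alpha> + 3*\<alpha>^2 = (2*\<Delta>*h)^2*B + (2*\<Delta>*h)*2*A*\<alpha> + 3*\<alpha>^2" using h(2) by simp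
  also have "\<dots> = - (9 * h^2 * disc_monic_cubic A B C)"
    unfolding \<alpha>_def N_def \<Delta>_def disc_monic_cubic_def by algebra
  finally have B: "B - (\<alpha>^2 + 2*\<alpha>*(- A - 2*\<alpha>)) = - (9 * h^2 * disc_monic_cubic A B C)"
    by (simp add: algebra_simps power2_eq_square)
  have "C - A*\<alpha>^2 - 2*\<alpha>^3 = (2*\<Delta>*h)^3*C - (2*\<Delta>*h)*A*\<alpha>^2 - 2*\<alpha>^3" using h(2) by simp
  also have "\<dots> = h^3 * (54*C - 2*A^3) * disc_monic_cubic A B C"
    unfolding \<alpha>_def N_def \<Delta>_def disc_monic_cubic_def by algebra
  finally have C: "C + \<alpha>^2*(- A - 2*\<alpha>) = h^3 * (54*C - 2*A^3) * disc_monic_cubic A B C"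
    by (simp add: algebra_simps power2_eq_square power3_eq_cube)
  have "vge 0 \<alpha>" unfolding \<alpha>_def N_def by (rule vge_weaken, (rule ABC h vge_calc)+, simp)
  moreover from this have "vge 0 (- A - 2*\<alpha>)" using ABC(1)
    by - (rule vge_weaken, (assumption | rule vge_calc)+, simp)
  moreover have "vge 1 (B - (\<alpha>^2 + 2*\<alpha>*(- A - 2*\<alpha>)))" "vge 1 (C + \<alpha>^2*(- A - 2*\<alpha>))"
    unfolding B C by (rule vge_weaken, (rule ABC disc h vge_calc)+, simp)+
  ultimately show ?thesis by (intro exI[of _ \<alpha>] exI[of _ "- A - 2*\<alpha>"]) simp
qed

text \<open>In residue characteristic 3 both \<open>A\<close> and \<open>B\<close> lie in the
  maximal ideal, and the root is a cube root of -C from perfectness; otherwise it is -A/3.\<close>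

lemma triple_root:
  assumes ABC: "vge 0 A" "vge 0 B" "vge 0 C" and disc: "vge 1 (disc_monic_cubic A B C)"
    and nonunit: "vge 1 (A^2 - 3*B)"
  shows "\<exists>\<alpha>. vge 0 \<alpha> \<and> vge 1 (A + 3*\<alpha>) \<and> vge 1 (B - 3*\<alpha>^2) \<and> vge 1 (C + \<alpha>^3)"
proof (cases "vge 1 3")
  case True
  then obtain \<alpha> where \<alpha>: "vge 0 \<alpha>" "vge 1 (\<alpha>^3 - (- C))"
    using residue_root[of 3 "- C"] ABC vge_minus by auto
  have A: "vge 1 A"
  proof (rule vge_square)
    have "A^2 = (A^2 - 3*B) + 3*B" by simp
    also have "vge (2 * 1 - 1) \<dots>" by (rule vge_weaken, (rule nonunit True ABC vge_calc)+, simp)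
    finally show "vge (2 * 1 - 1) (A^2)" .
  qed
  have B: "vge 1 B"
  proof (rule vge_cube)
    have "B^3 = A*(A*B^2 - 4*A^2*C + 18*B*C) - 3*(9*C^2) - disc_monic_cubic A B C - 3*B^3"
      unfolding disc_monic_cubic_def by algebra
    also have "vge (3 * 1 - 2) \<dots>"
      by (rule vge_weaken, (rule disc A True ABC vge_calc)+, simp)
    finally show "vge (3 * 1 - 2) (B^3)" .
  qed
  have "vge 1 (A + 3*\<alpha>)" "vge 1 (B - 3*\<alpha>^2)"
    by (rule vge_weaken, (rule A B True \<alpha> vge_calc)+, simp)+
  with \<alpha> show ?thesis by (auto simp: add.commute)
next
  case False
  from vge_unit_inverse[OF vge_numeral this] obtain h where h: "vge 0 h" "3 * h = 1"
    by (intro that[of "1/3"]) auto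
  \<comment> \<open>This is 27 times the value of the cubic at -A/3.\<close>
  define w where "w = 27*C + 2*A^3 - 9*A*B"
  have w: "vge 1 w"
  proof (rule vge_square)
    have "w^2 = 4*(A^2 - 3*B)^3 - 27*disc_monic_cubic A B C"
      unfolding disc_monic_cubic_def w_def by algebra
    also have "vge (2 * 1 - 1) \<dots>" by (rule vge_weaken, (rule nonunit disc vge_calc)+, simp)
    finally show "vge (2 * 1 - 1) (w^2)" .
  qed
  have "A + 3*(- (A*h)) = 0" using h(2) by algebra
  then have "vge 1 (A + 3*(- (A*h)))" by (simp only: vge_0)
  moreover have "B - 3*(- (A*h))^2 = - (h*(A^2 - 3*B))" using h(2) by algebra
  moreover have "C + (- (A*h))^3 = (3*h)^3*C - A^3*h^3" using h(2) by (simp add: power_mult_distrib)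
  moreover have "\<dots> = h^3*(w - 3*(A*(A^2 - 3*B)))" unfolding w_def by algebra
  moreover have "vge 1 (- (h*(A^2 - 3*B)))" "vge 1 (h^3*(w - 3*(A*(A^2 - 3*B))))" "vge 0 (- (A*h))"
    by (rule vge_weaken, (rule nonunit w h ABC vge_calc)+, simp)+
  ultimately show ?thesis by (intro exI[of _ "- (A*h)"]) (simp only: simp_thms)
qed

lemma repeated_root:
  assumes "vge 0 A" "vge 0 B" "vge 0 C" "vge 1 (disc_monic_cubic A B C)"
  shows "\<exists>\<alpha> \<beta>. vge 0 \<alpha> \<and> vge 0 \<beta> \<and> vge 1 (A + (2*\<alpha> + \<beta>)) \<and> vge 1 (B - (\<alpha>^2 + 2*\<alpha>*\<beta>)) \<and> vge 1 (C + \<alpha>^2*\<beta>)"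
proof (cases "vge 1 (A^2 - 3*B)")
  case True
  with triple_root[OF assms] obtain \<alpha>
    where "vge 0 \<alpha>" "vge 1 (A + 3*\<alpha>)" "vge 1 (B - 3*\<alpha>^2)" "vge 1 (C + \<alpha>^3)" by blast
  then show ?thesis
    by (intro exI[of _ \<alpha>]) (simp add: algebra_simps power2_eq_square power3_eq_cube)
qed (rule repeated_root_unit[OF assms])

section \<open>The residual polynomials P and Q of the algorithm of Tate\<close>

lemma vge_uniformizer_power:
  assumes "v \<pi> = 1" shows "v (\<pi> ^ k) = ereal (of_int (int k))"
proof (induction k)
  case (Suc k)
  then show ?case by (simp add: v_mult assms one_ereal_def)
qed (simp add: v_one zero_ereal_def)

lemma vge_divide_uniformizer:
  assumes "v \<pi> = 1" shows "vge n (x / \<pi> ^ k) \<longleftrightarrow> vge (n + int k) x"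
proof -
  have "\<pi> ^ k * (x / \<pi> ^ k) = x" using assms v_inf[of \<pi>] by auto
  then show ?thesis using vge_mult_iff[OF vge_uniformizer_power[OF assms], of n k "x / \<pi> ^ k"] by simp
qed

text \<open>Dividing by powers of \<pi> turns \<open>cubic_delta e\<close> into the discriminant of
  P and a2^2 - 3a4 into A^2 - 3B, which is (\<alpha> - \<beta>)^2 modulo the maximal ideal.\<close>

lemma tate_P_factor_iff:
  assumes \<pi>: "v \<pi> = 1" and N6: "tate_N6 v e"
  shows "(\<exists>\<alpha> \<beta>. tate_P_factor v \<pi> e \<alpha> \<beta>) \<longleftrightarrow> vge 7 (cubic_delta e)"
    and "tate_P_factor v \<pi> e \<alpha> \<beta> \<Longrightarrow> vge 1 (\<alpha> - \<beta>) \<longleftrightarrow> vge 3 (wa2 e ^ 2 - 3 * wa4 e)"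
proof -
  define A where "A = wa2 e / \<pi>"
  define B where "B = wa4 e / \<pi>^2"
  define C where "C = wa6 e / \<pi>^3"
  have "\<pi> \<noteq> 0" using \<pi> v_inf[of \<pi>] by auto
  then have a: "wa2 e = \<pi> * A" "wa4 e = \<pi>^2 * B" "wa6 e = \<pi>^3 * C"
    by (simp_all add: A_def B_def C_def)
  have ABC: "vge 0 A" "vge 0 B" "vge 0 C"
    using N6[unfolded tate_N6_def v_to_vge] vge_divide_uniformizer[OF \<pi>, of 0 "wa2 e" 1] vge_divide_uniformizer[OF \<pi>, of 0 "wa4 e" 2]
      vge_divide_uniformizer[OF \<pi>, of 0 "wa6 e" 3]
    by (simp_all add: A_def B_def C_def)
  have delta: "vge 7 (cubic_delta e) \<longleftrightarrow> vge 1 (disc_monic_cubic A B C)"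
  proof -
    have "cubic_delta e = \<pi>^6 * disc_monic_cubic A B C"
      unfolding cubic_delta_def a disc_monic_cubic_def by algebra
    then show ?thesis using vge_mult_iff[OF vge_uniformizer_power[OF \<pi>], of 1 6] by simp
  qed
  have Delta: "vge 3 (wa2 e ^ 2 - 3 * wa4 e) \<longleftrightarrow> vge 1 (A^2 - 3*B)"
  proof -
    have "wa2 e ^ 2 - 3 * wa4 e = \<pi>^2 * (A^2 - 3*B)" unfolding a by algebra
    then show ?thesis using vge_mult_iff[OF vge_uniformizer_power[OF \<pi>], of 1 2] by simp
  qed
  have fac: "tate_P_factor v \<pi> e \<alpha> \<beta> \<longleftrightarrow> vge 0 \<alpha> \<and> vge 0 \<beta> \<and> vge 1 (A + (2*\<alpha> + \<beta>))
      \<and> vge 1 (B - (\<alpha>^2 + 2*\<alpha>*\<beta>)) \<and> vge 1 (C + \<alpha>^2*\<beta>)" for \<alpha> \<beta>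
    unfolding tate_P_factor_def v_to_vge A_def B_def C_def ..
  have cong: "vcong 0 A (- (2*\<alpha> + \<beta>))" "vcong 0 B (\<alpha>^2 + 2*\<alpha>*\<beta>)" "vcong 0 C (- (\<alpha>^2*\<beta>))"
    if "tate_P_factor v \<pi> e \<alpha> \<beta>" for \<alpha> \<beta>
  proof -
    have \<alpha>\<beta>: "vge 0 \<alpha>" "vge 0 \<beta>" using that unfolding fac by auto
    have "vge 0 (- (2*\<alpha> + \<beta>))" "vge 0 (\<alpha>^2 + 2*\<alpha>*\<beta>)" "vge 0 (- (\<alpha>^2*\<beta>))"
      by (rule vge_weaken, (rule \<alpha>\<beta> vge_calc)+, simp)+
    with that ABC show "vcong 0 A (- (2*\<alpha> + \<beta>))" "vcong 0 B (\<alpha>^2 + 2*\<alpha>*\<beta>)" "vcong 0 C (- (\<alpha>^2*\<beta>))"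
      unfolding vcong_def fac by (simp_all only: diff_minus_eq_add add_0 simp_thms)
  qed
  show "(\<exists>\<alpha> \<beta>. tate_P_factor v \<pi> e \<alpha> \<beta>) \<longleftrightarrow> vge 7 (cubic_delta e)"
  proof
    assume "\<exists>\<alpha> \<beta>. tate_P_factor v \<pi> e \<alpha> \<beta>"
    then obtain \<alpha> \<beta> where f: "tate_P_factor v \<pi> e \<alpha> \<beta>" by blast
    have "disc_monic_cubic (- (2*\<alpha> + \<beta>)) (\<alpha>^2 + 2*\<alpha>*\<beta>) (- (\<alpha>^2*\<beta>)) = 0"
      unfolding disc_monic_cubic_def by algebra
    with vcong_vge_iff[OF vcong_disc[of 0, simplified, OF cong[OF f]]]
    show "vge 7 (cubic_delta e)" unfolding delta by simp
  next
    assume "vge 7 (cubic_delta e)"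
    with repeated_root[OF ABC] show "\<exists>\<alpha> \<beta>. tate_P_factor v \<pi> e \<alpha> \<beta>"
      unfolding delta fac by blast
  qed
  assume f: "tate_P_factor v \<pi> e \<alpha> \<beta>"
  have "vcong 0 (A^2 - 3*B) ((- (2*\<alpha> + \<beta>))^2 - 3*(\<alpha>^2 + 2*\<alpha>*\<beta>))"
  proof -
    have "vcong (int 2 * 0) (A^2 - 3*B) ((- (2*\<alpha> + \<beta>))^2 - 3*(\<alpha>^2 + 2*\<alpha>*\<beta>))"
      by (rule cong[OF f] vcong_calc | simp)+
    then show ?thesis by simp
  qed
  also have "(- (2*\<alpha> + \<beta>))^2 - 3*(\<alpha>^2 + 2*\<alpha>*\<beta>) = (\<alpha> - \<beta>)^2" by algebra
  finally have "vge 1 (A^2 - 3*B) \<longleftrightarrow> vge 1 ((\<alpha> - \<beta>)^2)" using vcong_vge_iff[of 0] by fastforce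
  also have "\<dots> \<longleftrightarrow> vge 1 (\<alpha> - \<beta>)"
    using vge_square[of 1 "\<alpha> - \<beta>"] vge_power[of 1 "\<alpha> - \<beta>" 2] vge_weaken by auto
  finally show "vge 1 (\<alpha> - \<beta>) \<longleftrightarrow> vge 3 (wa2 e ^ 2 - 3 * wa4 e)" unfolding Delta ..
qed

text \<open>The discriminant of Y^2 + pY - q is p^2 + 4q, that is, b6 divided by \<pi>^4.\<close>

lemma tate_Q_repeated_iff:
  assumes \<pi>: "v \<pi> = 1" and coeffs_vge: "vge 2 (wa3 e)" "vge 4 (wa6 e)"
  shows "tate_Q_repeated v \<pi> e \<longleftrightarrow> vge 5 (wb6 e)"
proof -
  define p where "p = wa3 e / \<pi>^2"
  define q where "q = wa6 e / \<pi>^4"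
  have "\<pi> \<noteq> 0" using \<pi> v_inf[of \<pi>] by auto
  then have "wb6 e = \<pi>^4 * (p^2 + 4*q)"
    by (simp add: p_def q_def wb6_def field_simps power_divide flip: power_mult)
  then have b6: "vge 5 (wb6 e) \<longleftrightarrow> vge 1 (p^2 + 4*q)"
    using vge_mult_iff[OF vge_uniformizer_power[OF \<pi>], of 1 4] by simp
  have pq: "vge 0 p" "vge 0 q"
    using coeffs_vge vge_divide_uniformizer[OF \<pi>, of 0 _ 2] vge_divide_uniformizer[OF \<pi>, of 0 _ 4]
    by (simp_all add: p_def q_def)
  have "tate_Q_repeated v \<pi> e \<longleftrightarrow> (\<exists>\<gamma>. vge 0 \<gamma> \<and> vge 1 (p + 2*\<gamma>) \<and> vge 1 (- q - \<gamma>^2))"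
    unfolding tate_Q_repeated_def v_to_vge p_def q_def ..
  also have "\<dots> \<longleftrightarrow> vge 1 (p^2 + 4*q)"
  proof
    assume "\<exists>\<gamma>. vge 0 \<gamma> \<and> vge 1 (p + 2*\<gamma>) \<and> vge 1 (- q - \<gamma>^2)"
    then obtain \<gamma> where \<gamma>: "vge 0 \<gamma>" "vge 1 (p + 2*\<gamma>)" "vge 1 (- q - \<gamma>^2)" by blast
    have "p^2 + 4*q = (p - 2*\<gamma>)*(p + 2*\<gamma>) - 4*(- q - \<gamma>^2)" by algebra
    also have "vge 1 \<dots>" by (rule vge_weaken, (rule \<gamma> pq vge_calc)+, simp)
    finally show "vge 1 (p^2 + 4*q)" .
  next
    assume "vge 1 (p^2 + 4*q)"
    with double_root[OF pq] obtain s where s: "vge 0 s" "vge 1 (2*s + p)" "vge 1 (s^2 + p*s - q)" by blast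
    have "- q - s^2 = (s^2 + p*s - q) - s*(2*s + p)" by algebra
    also have "vge 1 \<dots>" by (rule vge_weaken, (rule s vge_calc)+, simp)
    finally show "\<exists>\<gamma>. vge 0 \<gamma> \<and> vge 1 (p + 2*\<gamma>) \<and> vge 1 (- q - \<gamma>^2)"
      using s by (auto simp: add.commute)
  qed
  finally show ?thesis unfolding b6 .
qed

end

section \<open>Coordinate changes, minimality and uniqueness of the type\<close>

lemma wchange_simps [simp]:
  "wa1 (wchange e u r s t) = (wa1 e + 2*s) / u"
  "wa2 (wchange e u r s t) = (wa2 e - s*wa1 e + 3*r - s^2) / u^2"
  "wa3 (wchange e u r s t) = (wa3 e + r*wa1 e + 2*t) / u^3"
  "wa4 (wchange e u r s t) = (wa4 e - s*wa3 e + 2*r*wa2 e - (t + r*s)*wa1 e + 3*r^2 - 2*s*t) / u^4"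
  "wa6 (wchange e u r s t) = (wa6 e + r*wa4 e + r^2*wa2 e + r^3 - t*wa3 e - t^2 - r*t*wa1 e) / u^6"
  by (simp_all add: wchange_def Let_def)

lemma wchange_id [simp]: "wchange e 1 0 0 0 = e"
  by (cases e) (simp add: wchange_def)

lemma wchange_scale:
  assumes "u \<noteq> 0"
  shows "wa1 (wchange e 1 r s t) = u * wa1 (wchange e u r s t)"
    "wa2 (wchange e 1 r s t) = u^2 * wa2 (wchange e u r s t)"
    "wa3 (wchange e 1 r s t) = u^3 * wa3 (wchange e u r s t)"
    "wa4 (wchange e 1 r s t) = u^4 * wa4 (wchange e u r s t)"
    "wa6 (wchange e 1 r s t) = u^6 * wa6 (wchange e u r s t)"
  using assms by simp_all

lemma wchange_wchange:
  assumes "u \<noteq> 0" "u' \<noteq> 0"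
  shows "wchange (wchange e u r s t) u' r' s' t'
    = wchange e (u*u') (r + u^2*r') (s + u*s') (t + u^3*t' + u^2*s*r')"
proof (rule weq.expand, simp, intro conjI)
qed (use assms in \<open>simp_all add: field_simps power_numeral_reduce\<close>)

lemma weq_iso_refl: "weq_iso e e"
  unfolding weq_iso_def by (intro exI[of _ 1] exI[of _ 0]) simp

lemma weq_iso_trans: "weq_iso e f \<Longrightarrow> weq_iso f g \<Longrightarrow> weq_iso e g"
  unfolding weq_iso_def by (metis wchange_wchange mult_eq_0_iff)

lemma wchange_inverse:
  assumes "u \<noteq> 0"
  shows "wchange (wchange e u r s t) (1/u) (- r/u^2) (- s/u) ((r*s - t)/u^3) = e"
proof -
  have "t + u^3*((r*s - t)/u^3) + u^2*s*(- r/u^2) = 0" using assms by simp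
  moreover have "r + u^2*(- r/u^2) = 0" "s + u*(- s/u) = 0" "u * (1/u) = 1" using assms by simp_all
  ultimately show ?thesis using assms by (subst wchange_wchange) simp_all
qed

lemma weq_iso_sym: "weq_iso e f \<Longrightarrow> weq_iso f e"
  unfolding weq_iso_def by (metis wchange_inverse divide_eq_0_iff one_neq_zero)

lemma wb_shift:
  "wb2 (wchange e 1 r s t) = wb2 e + 12*r"
  "wb4 (wchange e 1 r s t) = wb4 e + r*wb2 e + 6*r^2"
  "wb6 (wchange e 1 r s t) = wb6 e + 2*r*wb4 e + r^2*wb2 e + 4*r^3"
  "wb8 (wchange e 1 r s t) = wb8 e + 3*r*wb6 e + 3*r^2*wb4 e + r^3*wb2 e + 3*r^4"
  by (simp_all add: wb2_def wb4_def wb6_def wb8_def algebra_simps power_numeral_reduce)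

lemma wb_scale:
  assumes "u \<noteq> 0"
  shows "wb2 (wchange e 1 r s t) = u^2 * wb2 (wchange e u r s t)"
    "wb4 (wchange e 1 r s t) = u^4 * wb4 (wchange e u r s t)"
    "wb6 (wchange e 1 r s t) = u^6 * wb6 (wchange e u r s t)"
    "wb8 (wchange e 1 r s t) = u^8 * wb8 (wchange e u r s t)"
  unfolding wb2_def wb4_def wb6_def wb8_def wchange_scale[OF assms] by algebra+

lemma wb8_relation: "4 * wb8 e = wb2 e * wb6 e - wb4 e ^ 2"
  by (simp add: wb2_def wb4_def wb6_def wb8_def algebra_simps power_numeral_reduce)

lemma wdisc_shift: "wdisc (wchange e 1 r s t) = wdisc e"
proof -
  \<comment> \<open>As a polynomial in b2, b4, b6, b8 the discriminant is invariant only modulo the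
    relation 4 b8 = b2 b6 - b4^2, so the multiple of that relation is made explicit.\<close>
  have "wdisc (wchange e 1 r s t)
      = wdisc e - (4 * wb8 e - (wb2 e * wb6 e - wb4 e ^ 2)) * (6 * wb2 e * r + 36 * r^2)"
    unfolding wdisc_def wb_shift by (simp add: algebra_simps power_numeral_reduce)
  then show ?thesis by (simp add: wb8_relation)
qed

lemma wdisc_scale: "u \<noteq> 0 \<Longrightarrow> wdisc (wchange e u r s t) = (1/u)^12 * wdisc e"
proof -
  assume u: "u \<noteq> 0"
  have "wdisc e = u^12 * wdisc (wchange e u r s t)"
    unfolding wdisc_shift[of e r s t, symmetric] unfolding wdisc_def wb_scale[OF u] by algebra
  then show ?thesis using u by (simp add: power_divide)
qed

section \<open>Integrality of coordinate changes, and the order of the types\<close>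

context dvf
begin

text \<open>A valuation ring is integrally closed: for v(x) = n < 0 the left side has valuation 2n,
  the right side at least n.\<close>

lemma vge_monic_quadratic:
  assumes "x^2 = p*x + q" "vge 0 p" "vge 0 q" shows "vge 0 x"
proof (rule ccontr)
  assume x: "\<not> vge 0 x"
  then have "x \<noteq> 0" by auto
  then obtain n where n: "v x = ereal (of_int n)" by (rule v_int)
  with x have "n < 0" by (simp add: vge_def)
  have "vge n x" by (simp add: vge_def n)
  have "vge n (p*x + q)"
    by (rule vge_weaken, (rule assms \<open>vge n x\<close> vge_calc)+) (use \<open>n < 0\<close> in simp)
  then have "vge n (x*x)" using assms by (simp add: power2_eq_square)
  then show False using \<open>n < 0\<close> by (simp add: vge_def v_mult n)
qed

lemma vge_monic_quartic:
  assumes "x^4 = p*x^2 + q*x + w" "vge 0 p" "vge 0 q" "vge 0 w" shows "vge 0 x"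
proof (rule ccontr)
  assume x: "\<not> vge 0 x"
  then have "x \<noteq> 0" by auto
  then obtain n where n: "v x = ereal (of_int n)" by (rule v_int)
  with x have "n < 0" by (simp add: vge_def)
  have "vge n x" by (simp add: vge_def n)
  have "vge (2*n) (p*x^2 + q*x + w)"
    by (rule vge_weaken, (rule assms \<open>vge n x\<close> vge_calc)+) (use \<open>n < 0\<close> in simp)
  then have "vge (2*n) (x*x*(x*x))" using assms by (simp add: power_numeral_reduce mult.assoc)
  then show False using \<open>n < 0\<close> by (simp add: vge_def v_mult n)
qed

lemma integral_weq_iff: "integral_weq v e \<longleftrightarrow> coeffs_vge e 0 0 0 0 0"
  by (simp add: integral_weq_def coeffs_vge_def v_to_vge)

lemma wb_integral:
  assumes "coeffs_vge e 0 0 0 0 0" shows "vge 0 (wb2 e)" "vge 0 (wb4 e)" "vge 0 (wb6 e)" "vge 0 (wb8 e)"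
proof -
  have a: "vge 0 (wa1 e)" "vge 0 (wa2 e)" "vge 0 (wa3 e)" "vge 0 (wa4 e)" "vge 0 (wa6 e)"
    using assms unfolding coeffs_vge_def by blast+
  show "vge 0 (wb2 e)" "vge 0 (wb4 e)" "vge 0 (wb6 e)" "vge 0 (wb8 e)"
    unfolding wb2_def wb4_def wb6_def wb8_def by (rule vge_weaken, (rule a vge_calc)+, simp)+
qed

lemma shift_integral:
  assumes e: "coeffs_vge e 0 0 0 0 0" and f: "coeffs_vge (wchange e 1 r s t) 0 0 0 0 0"
  shows "vge 0 r" "vge 0 s" "vge 0 t"
proof -
  let ?f = "wchange e 1 r s t"
  have a1: "vge 0 (wa1 e)" and a2: "vge 0 (wa2 e)" and a3: "vge 0 (wa3 e)" and a4: "vge 0 (wa4 e)"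
    and a6: "vge 0 (wa6 e)" using e unfolding coeffs_vge_def by auto
  have c2: "vge 0 (wa2 ?f)" and c6: "vge 0 (wa6 ?f)" using f unfolding coeffs_vge_def by blast+
  show r: "vge 0 r"
  proof (rule vge_monic_quartic)
    \<comment> \<open>Multiplying the cubic for \<open>r\<close> given by \<open>b\<^sub>6\<close> (leading coefficient 4) by \<open>r\<close> and subtracting the
      quartic given by \<open>b\<^sub>8\<close> (leading coefficient 3) leaves a monic equation.\<close>
    show "r^4 = wb4 e * r^2 + (2*wb6 e + wb6 ?f)*r + (wb8 e - wb8 ?f)"
      unfolding wb_shift by (simp add: algebra_simps power_numeral_reduce)
    show "vge 0 (wb4 e)" "vge 0 (2*wb6 e + wb6 ?f)" "vge 0 (wb8 e - wb8 ?f)"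
      by (rule vge_weaken, (rule wb_integral[OF e] wb_integral[OF f] vge_calc)+, simp)+
  qed
  \<comment> \<open>With \<open>r\<close> integral, the transformation of a2 is a monic quadratic
    equation for \<open>s\<close>, and that of a6 one for \<open>t\<close>.\<close>
  show "vge 0 s"
  proof (rule vge_monic_quadratic)
    show "s^2 = (- wa1 e)*s + (wa2 e + 3*r - wa2 ?f)" by simp
    show "vge 0 (- wa1 e)" "vge 0 (wa2 e + 3*r - wa2 ?f)"
      by (rule vge_weaken, (rule a1 a2 c2 r vge_calc)+, simp)+
  qed
  show "vge 0 t"
  proof (rule vge_monic_quadratic)
    show "t^2 = (- wa3 e - r*wa1 e)*t + (wa6 e + r*wa4 e + r^2*wa2 e + r^3 - wa6 ?f)"
      by (simp add: algebra_simps)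
    show "vge 0 (- wa3 e - r*wa1 e)" "vge 0 (wa6 e + r*wa4 e + r^2*wa2 e + r^3 - wa6 ?f)"
      by (rule vge_weaken, (rule a1 a2 a3 a4 a6 c6 r vge_calc)+, simp)+
  qed
qed

text \<open>The conditions of the paper in terms of integral lower bounds only.\<close>
fun type_cond :: "kodaira \<Rightarrow> 'k weq \<Rightarrow> bool" where
  "type_cond II e \<longleftrightarrow> coeffs_vge e 1 1 1 1 1 \<and> \<not> vge 2 (wa6 e)"
| "type_cond III e \<longleftrightarrow> coeffs_vge e 1 1 1 1 2 \<and> \<not> vge 2 (wa4 e)"
| "type_cond IV e \<longleftrightarrow> coeffs_vge e 1 1 1 2 2 \<and> \<not> vge 3 (wb6 e)"
| "type_cond I0s e \<longleftrightarrow> coeffs_vge e 1 1 2 2 3 \<and> \<not> vge 7 (cubic_delta e)"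
| "type_cond Ins_pos e \<longleftrightarrow> coeffs_vge e 1 1 2 2 3 \<and> vge 7 (cubic_delta e) \<and> \<not> vge 3 (wa2 e ^ 2 - 3 * wa4 e)"
| "type_cond IVs e \<longleftrightarrow> coeffs_vge e 1 2 2 3 4 \<and> \<not> vge 5 (wb6 e)"
| "type_cond IIIs e \<longleftrightarrow> coeffs_vge e 1 2 3 3 5 \<and> \<not> vge 4 (wa4 e)"
| "type_cond IIs e \<longleftrightarrow> coeffs_vge e 1 2 3 4 5 \<and> \<not> vge 6 (wa6 e)"

text \<open>Satisfied by the models of every type that comes after the given one.  \<open>beyond IIs\<close>
  says that the model is not minimal.\<close>
fun beyond :: "kodaira \<Rightarrow> 'k weq \<Rightarrow> bool" where
  "beyond II e \<longleftrightarrow> coeffs_vge e 1 1 1 1 2"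
| "beyond III e \<longleftrightarrow> coeffs_vge e 1 1 1 2 2"
| "beyond IV e \<longleftrightarrow> coeffs_vge e 1 1 2 2 3"
| "beyond I0s e \<longleftrightarrow> coeffs_vge e 1 1 2 2 3 \<and> vge 7 (cubic_delta e)"
| "beyond Ins_pos e \<longleftrightarrow> coeffs_vge e 1 2 2 3 4"
| "beyond IVs e \<longleftrightarrow> coeffs_vge e 1 2 3 3 5"
| "beyond IIIs e \<longleftrightarrow> coeffs_vge e 1 2 3 4 5"
| "beyond IIs e \<longleftrightarrow> coeffs_vge e 1 2 3 4 6"

lemma coeffs_vge_mono:
  assumes "coeffs_vge e n1 n2 n3 n4 n6" "m1 \<le> n1" "m2 \<le> n2" "m3 \<le> n3" "m4 \<le> n4" "m6 \<le> n6"
  shows "coeffs_vge e m1 m2 m3 m4 m6"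
  using assms vge_weaken unfolding coeffs_vge_def by blast

lemma coeffs_vge_cubic_delta: "coeffs_vge e 1 2 2 3 4 \<Longrightarrow> vge 7 (cubic_delta e)"
proof -
  assume "coeffs_vge e 1 2 2 3 4"
  then have a: "vge 2 (wa2 e)" "vge 3 (wa4 e)" "vge 4 (wa6 e)" unfolding coeffs_vge_def by auto
  show ?thesis unfolding cubic_delta_def disc_monic_cubic_def
    by (rule vge_weaken, (rule a vge_calc)+, simp)
qed

lemma type_cond_imp_beyond:
  "type_cond III e \<Longrightarrow> beyond II e" "type_cond IV e \<Longrightarrow> beyond III e" "type_cond I0s e \<Longrightarrow> beyond IV e" "type_cond Ins_pos e \<Longrightarrow> beyond I0s e"
  "type_cond IVs e \<Longrightarrow> beyond Ins_pos e" "type_cond IIIs e \<Longrightarrow> beyond IVs e" "type_cond IIs e \<Longrightarrow> beyond IIIs e"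
  by auto

lemma beyond_step:
  "beyond III e \<Longrightarrow> beyond II e" "beyond IV e \<Longrightarrow> beyond III e" "beyond I0s e \<Longrightarrow> beyond IV e" "beyond Ins_pos e \<Longrightarrow> beyond I0s e"
  "beyond IVs e \<Longrightarrow> beyond Ins_pos e" "beyond IIIs e \<Longrightarrow> beyond IVs e" "beyond IIs e \<Longrightarrow> beyond IIIs e"
  by (auto intro: coeffs_vge_mono coeffs_vge_cubic_delta)

lemma beyond_IIs_imp: "beyond IIs e \<Longrightarrow> beyond T e"
  by (cases T) (use beyond_step in blast)+

text \<open>The order in which the algorithm of Tate tests for the types.\<close>

fun type_index :: "kodaira \<Rightarrow> nat" where
  "type_index II = 0" | "type_index III = 1" | "type_index IV = 2" | "type_index I0s = 3" | "type_index Ins_pos = 4"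
| "type_index IVs = 5" | "type_index IIIs = 6" | "type_index IIs = 7"

lemma type_index_inj: "type_index T = type_index T' \<Longrightarrow> T = T'"
  by (cases T; cases T') simp_all

lemma type_cond_beyond: "type_cond T e \<Longrightarrow> type_index T' < type_index T \<Longrightarrow> beyond T' e"
  by (cases T; cases T'; simp only: type_index.simps; (use type_cond_imp_beyond beyond_step in blast)?; simp)

lemma type_cond_coeffs: "type_cond T e \<Longrightarrow> coeffs_vge e 1 1 1 1 1"
  by (cases T) (auto intro: coeffs_vge_mono)

lemma beyond_coeffs: "beyond T e \<Longrightarrow> coeffs_vge e 1 1 1 1 1"
  by (cases T) (auto intro: coeffs_vge_mono)

lemma beyond_scale:
  assumes "vge 0 u" "u \<noteq> 0" "beyond T (wchange e u r s t)" shows "beyond T (wchange e 1 r s t)"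
proof -
  have *: "vge n (u^k * x)" if "vge n x" for n k x
    using vge_mult[OF vge_power[OF assms(1)] that, of k] by simp
  have "cubic_delta (wchange e 1 r s t) = u^12 * cubic_delta (wchange e u r s t)"
    unfolding cubic_delta_def disc_monic_cubic_def wchange_scale[OF assms(2)] by algebra
  then show ?thesis using assms(3) *[of _ _ 1]
    by (cases T) (simp_all only: beyond.simps coeffs_vge_def wchange_scale[OF assms(2)] * power_one_right simp_thms)
qed

text \<open>The \<open>pass\<close> lemmas carry the bound that \<open>beyond\<close> gives for the
  shifted model back to \<open>e\<close>, where \<open>type_cond\<close> denies it.\<close>

lemma type_cond_shift_not_beyond:
  assumes type_cond: "type_cond T e" and beyond: "beyond T (wchange e 1 r s t)"
  shows False
proof -
  have "coeffs_vge e 1 1 1 1 1" "coeffs_vge (wchange e 1 r s t) 1 1 1 1 1"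
    using type_cond_coeffs[OF type_cond] beyond_coeffs[OF beyond] by auto
  moreover from this have "vge 0 r" "vge 0 s" "vge 0 t"
    by (auto intro!: shift_integral[of e r s t] elim!: coeffs_vge_mono)
  ultimately interpret dvf_shift v "wa1 e" "wa2 e" "wa3 e" "wa4 e" "wa6 e"
    "wa1 (wchange e 1 r s t)" "wa2 (wchange e 1 r s t)" "wa3 (wchange e 1 r s t)"
    "wa4 (wchange e 1 r s t)" "wa6 (wchange e 1 r s t)" r s t
    by unfold_locales (auto simp: coeffs_vge_def)
  let ?f = "wchange e 1 r s t"
  show False
  proof (cases T)
    case II with type_cond beyond pass_II show ?thesis by (simp add: coeffs_vge_def del: wchange_simps)
  next
    case III with type_cond beyond pass_III show ?thesis by (simp add: coeffs_vge_def del: wchange_simps)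
  next
    case IV with type_cond beyond pass_IV show ?thesis by (simp add: coeffs_vge_def wb6_def del: wchange_simps)
  next
    case I0s with type_cond beyond pass_I0s show ?thesis
      by (simp add: coeffs_vge_def cubic_delta_def del: wchange_simps)
  next
    case Ins_pos
    with beyond have "coeffs_vge ?f 1 2 2 3 4" by (simp only: beyond.simps)
    then have "coeffs_vge ?f 1 1 2 2 3" by (rule coeffs_vge_mono) simp_all
    from \<open>coeffs_vge ?f 1 2 2 3 4\<close> have a: "vge 2 (wa2 ?f)" "vge 3 (wa4 ?f)" unfolding coeffs_vge_def by blast+
    have "vge 3 (wa2 ?f ^ 2 - 3 * wa4 ?f)" by (rule vge_weaken, (rule a vge_calc)+, simp)
    with Ins_pos type_cond pass_Ins \<open>coeffs_vge ?f 1 1 2 2 3\<close> show ?thesis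
      by (simp add: coeffs_vge_def del: wchange_simps)
  next
    case IVs with type_cond beyond pass_IVs show ?thesis by (simp add: coeffs_vge_def wb6_def del: wchange_simps)
  next
    case IIIs with type_cond beyond pass_IIIs show ?thesis by (simp add: coeffs_vge_def del: wchange_simps)
  next
    case IIs
    with type_cond beyond pass_IIs vge_weaken[of 4 "wa4 e" 3] vge_weaken[of 6 "wa6 ?f" 5] show ?thesis
      by (simp add: coeffs_vge_def del: wchange_simps)
  qed
qed

text \<open>If \<open>u\<close> were in the maximal ideal, undoing the scaling would multiply each
  a_i by u^i and so produce a shift of \<open>e\<close> with v(a_i) at least i, which lies beyond
  every type.\<close>

lemma type_cond_scale_unit:
  assumes type_cond: "type_cond T e" and u: "u \<noteq> 0" and f: "coeffs_vge (wchange e u r s t) 0 0 0 0 0"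
  shows "\<not> vge 1 u"
proof
  assume vge1: "vge 1 u"
  have *: "vge (int k) (u^k * x)" if "vge 0 x" for k x
    using vge_mult[OF vge_power[OF vge1] that, of k] by simp
  have "beyond IIs (wchange e 1 r s t)"
    using f *[of _ 1] *[of _ 2] *[of _ 3] *[of _ 4] *[of _ 6]
    by (simp add: coeffs_vge_def wchange_scale[OF u] del: wchange_simps)
  then show False using type_cond_shift_not_beyond[OF type_cond] beyond_IIs_imp by blast
qed

lemma not_vge_1_inverse:
  assumes "u \<noteq> 0" "\<not> vge 1 u" shows "vge 0 (1/u)"
proof -
  obtain n where n: "v u = ereal (of_int n)" using v_int assms(1) by blast
  then have "n \<le> 0" using assms by (simp add: vge_def)
  then show ?thesis using vge_mult_iff[OF n, of "- n" "1/u"] assms vge_1 vge_weaken by auto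
qed

text \<open>A change to an integral model has v(u) at most 0, and it subtracts 12 v(u) from the
  valuation of the discriminant.\<close>

lemma type_cond_minimal: assumes type_cond: "type_cond T e" shows "minimal_model v e"
  unfolding minimal_model_def integral_weq_iff
proof (intro conjI allI impI; (elim conjE)?)
  show "coeffs_vge e 0 0 0 0 0" using type_cond_coeffs[OF type_cond] by (auto intro: coeffs_vge_mono)
next
  fix f assume "weq_iso e f" "coeffs_vge f 0 0 0 0 0"
  then obtain u r s t where u: "u \<noteq> 0" and f: "f = wchange e u r s t" unfolding weq_iso_def by blast
  have "vge 0 (1/u)" using type_cond_scale_unit[OF type_cond u] \<open>coeffs_vge f 0 0 0 0 0\<close> not_vge_1_inverse[OF u] f by blast
  from vge_power[OF this, of 12] have "0 \<le> v ((1/u)^12)" by (simp add: vge_def zero_ereal_def)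
  then show "v (wdisc e) \<le> v (wdisc f)"
    unfolding f wdisc_scale[OF u] v_mult by (simp add: add_increasing)
qed

text \<open>Applied to \<open>e'\<close> and the inverse change, the bound on the scaling factor
  gives v(u) at least 0. Then \<open>beyond_scale\<close> reduces to \<open>u = 1\<close>, where the
  earlier type of \<open>e\<close> excludes the later one.\<close>

lemma type_cond_unique_aux:
  assumes "type_cond T e" "type_cond T' e'" "weq_iso e e'" "type_index T < type_index T'" shows False
proof -
  obtain u r s t where u: "u \<noteq> 0" and e': "e' = wchange e u r s t"
    using assms(3) unfolding weq_iso_def by blast
  have "e = wchange e' (1/u) (- r/u^2) (- s/u) ((r*s - t)/u^3)"
    unfolding e' wchange_inverse[OF u] ..
  moreover have "coeffs_vge e 0 0 0 0 0" using type_cond_coeffs[OF assms(1)] by (auto intro: coeffs_vge_mono)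
  ultimately have "\<not> vge 1 (1/u)" using type_cond_scale_unit[OF assms(2), of "1/u"] u by auto
  then have "vge 0 u" using not_vge_1_inverse[of "1/u"] u by simp
  moreover have "beyond T e'" by (rule type_cond_beyond[OF assms(2,4)])
  ultimately show False using type_cond_shift_not_beyond[OF assms(1)] beyond_scale u e' by blast
qed

lemma type_cond_unique: "type_cond T e \<Longrightarrow> type_cond T' e' \<Longrightarrow> weq_iso e e' \<Longrightarrow> T = T'"
  using type_cond_unique_aux weq_iso_sym type_index_inj by (metis linorder_neqE_nat)

end

section \<open>Comparison with the algorithm of Tate\<close>

context dvf
begin

text \<open>Modulo the maximal ideal b2 is the discriminant of T^2 + a1 T - a2. Its double root
  \<open>s\<close> is the slope of the cuspidal tangent, which y -> y + sx makes horizontal.\<close>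

lemma tate_N2_shift:
  assumes e: "coeffs_vge e 0 0 0 0 0" and N2: "tate_N2 v e"
  obtains f where "weq_iso e f" "coeffs_vge f 1 1 1 1 1" "wa6 f = wa6 e" "wb6 f = wb6 e" "wb8 f = wb8 e"
proof -
  have a: "vge 0 (wa1 e)" "vge 0 (wa2 e)" "vge 1 (wa3 e)" "vge 1 (wa4 e)" "vge 1 (wa6 e)"
    and "vge 1 (wa1 e ^ 2 + 4 * wa2 e)"
    using e N2 unfolding coeffs_vge_def tate_N2_def v_to_vge wb2_def by blast+
  with double_root obtain s where s: "vge 0 s" "vge 1 (2*s + wa1 e)" "vge 1 (s^2 + wa1 e*s - wa2 e)"
    by blast
  let ?f = "wchange e 1 0 s 0"
  show thesis
  proof
    show "weq_iso e ?f" unfolding weq_iso_def by (metis one_neq_zero)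
    have "vge 1 (- (s^2 + wa1 e*s - wa2 e))" "vge 1 (wa4 e - s*wa3 e)"
      by (rule vge_weaken, (rule a s vge_calc)+, simp)+
    with a s show "coeffs_vge ?f 1 1 1 1 1" by (simp add: coeffs_vge_def algebra_simps)
    show "wa6 ?f = wa6 e" "wb6 ?f = wb6 e" "wb8 ?f = wb8 e" unfolding wb_shift by simp_all
  qed
qed

text \<open>Every term of b8 except a4^2 has valuation at least 3 here, and a4^2 reaches 3 only if
  a4 reaches 2.\<close>

lemma vge_wb8_iff: assumes "coeffs_vge e 1 1 1 1 2" shows "vge 3 (wb8 e) \<longleftrightarrow> vge 2 (wa4 e)"
proof
  have a: "vge 1 (wa1 e)" "vge 1 (wa2 e)" "vge 1 (wa3 e)" "vge 2 (wa6 e)"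
    and a4: "vge 1 (wa4 e)" using assms unfolding coeffs_vge_def by blast+
  show "vge 3 (wb8 e)" if "vge 2 (wa4 e)"
    unfolding wb8_def by (rule vge_weaken, (rule that a vge_calc)+, simp)
  show "vge 2 (wa4 e)" if "vge 3 (wb8 e)"
  proof (rule vge_square)
    have "wa4 e^2 = wa1 e ^ 2 * wa6 e + 4 * wa2 e * wa6 e - wa1 e * wa3 e * wa4 e
          + wa2 e * wa3 e ^ 2 - wb8 e" unfolding wb8_def by simp
    also have "vge (2 * 2 - 1) \<dots>" by (rule vge_weaken, (rule that a a4 vge_calc)+, simp)
    finally show "vge (2 * 2 - 1) (wa4 e^2)" .
  qed
qed

text \<open>Only the types II, III and IV call for the substitution of \<open>tate_N2_shift\<close>;
  from I0* onwards the normal form itself is the witness.\<close>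

lemma tate_ends_imp_type_cond:
  assumes \<pi>: "v \<pi> = 1" and e: "coeffs_vge e 0 0 0 0 0" and T: "tate_ends v \<pi> T e"
  obtains f where "weq_iso e f" "type_cond T f"
proof (cases T)
  case II
  with T have "tate_N2 v e" "\<not> vge 2 (wa6 e)" unfolding v_to_vge by (auto simp only: tate_ends.simps v_to_vge)
  with tate_N2_shift[OF e] II that show ?thesis by (metis type_cond.simps(1))
next
  case III
  with T have N: "tate_N2 v e" "vge 2 (wa6 e)" "\<not> vge 3 (wb8 e)"
    by (auto simp only: tate_ends.simps v_to_vge)
  obtain f where f: "weq_iso e f" "coeffs_vge f 1 1 1 1 1" "wa6 f = wa6 e" "wb8 f = wb8 e"
    using tate_N2_shift[OF e N(1)] by metis
  then have "coeffs_vge f 1 1 1 1 2" using N unfolding coeffs_vge_def by simp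
  with vge_wb8_iff[OF this] f N III that show ?thesis by simp
next
  case IV
  with T have N: "tate_N2 v e" "vge 2 (wa6 e)" "vge 3 (wb8 e)" "\<not> vge 3 (wb6 e)"
    by (auto simp only: tate_ends.simps v_to_vge)
  obtain f where f: "weq_iso e f" "coeffs_vge f 1 1 1 1 1" "wa6 f = wa6 e" "wb8 f = wb8 e" "wb6 f = wb6 e"
    using tate_N2_shift[OF e N(1)] by metis
  then have "coeffs_vge f 1 1 1 1 2" using N unfolding coeffs_vge_def by simp
  moreover from vge_wb8_iff[OF this] f N have "vge 2 (wa4 f)" by simp
  ultimately have "coeffs_vge f 1 1 1 2 2" unfolding coeffs_vge_def by simp
  with f N IV that show ?thesis by simp
next
  case I0s
  with T tate_P_factor_iff(1)[OF \<pi>] have "type_cond I0s e"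
    by (auto simp only: tate_ends.simps type_cond.simps tate_N6_def v_to_vge coeffs_vge_def)
  with I0s that weq_iso_refl show ?thesis by blast
next
  case Ins_pos
  with T obtain \<alpha> \<beta> where N6: "tate_N6 v e" and P: "tate_P_factor v \<pi> e \<alpha> \<beta>" "\<not> vge 1 (\<alpha> - \<beta>)"
    by (auto simp only: tate_ends.simps v_to_vge)
  with tate_P_factor_iff[OF \<pi> N6] have "vge 7 (cubic_delta e)" "\<not> vge 3 (wa2 e ^ 2 - 3 * wa4 e)"
    by blast+
  with N6 have "type_cond Ins_pos e" by (simp only: type_cond.simps tate_N6_def v_to_vge coeffs_vge_def simp_thms)
  with Ins_pos that weq_iso_refl show ?thesis by blast
next
  case IVs
  with T have "coeffs_vge e 1 2 2 3 4" "\<not> tate_Q_repeated v \<pi> e"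
    by (auto simp only: tate_ends.simps tate_N8_def tate_N6_def v_to_vge coeffs_vge_def)
  with tate_Q_repeated_iff[OF \<pi>, of e] have "type_cond IVs e" by (auto simp: coeffs_vge_def)
  with IVs that weq_iso_refl show ?thesis by blast
next
  case IIIs
  with T have "type_cond IIIs e"
    by (auto simp only: tate_ends.simps type_cond.simps tate_N8_def tate_N6_def v_to_vge coeffs_vge_def)
  with IIIs that weq_iso_refl show ?thesis by blast
next
  case IIs
  with T have "type_cond IIs e"
    by (auto simp only: tate_ends.simps type_cond.simps tate_N8_def tate_N6_def v_to_vge coeffs_vge_def)
  with IIs that weq_iso_refl show ?thesis by blast
qed

lemma coeffs_vge_tate_N2: assumes "coeffs_vge e 1 1 1 1 1" shows "tate_N2 v e"
proof -
  have a: "vge 1 (wa1 e)" "vge 1 (wa2 e)" "vge 1 (wa3 e)" "vge 1 (wa4 e)" "vge 1 (wa6 e)"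
    using assms unfolding coeffs_vge_def by blast+
  have b: "vge 1 (wb2 e)" "vge 1 (wb4 e)" "vge 1 (wb6 e)" "vge 1 (wb8 e)"
    unfolding wb2_def wb4_def wb6_def wb8_def by (rule vge_weaken, (rule a vge_calc)+, simp)+
  have "vge 1 (wdisc e)" unfolding wdisc_def by (rule vge_weaken, (rule b vge_calc)+, simp)
  with a b show ?thesis by (simp only: tate_N2_def v_to_vge simp_thms)
qed

lemma type_cond_imp_tate_ends:
  assumes \<pi>: "v \<pi> = 1" and type_cond: "type_cond T e" shows "tate_ends v \<pi> T e"
proof -
  note N2 = coeffs_vge_tate_N2[OF type_cond_coeffs[OF type_cond]]
  show ?thesis
  proof (cases T)
    case II
    with type_cond N2 show ?thesis by (simp only: type_cond.simps tate_ends.simps v_to_vge simp_thms)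
  next
    case III
    with type_cond vge_wb8_iff[of e] have "\<not> vge 3 (wb8 e)" by simp
    with III type_cond N2 show ?thesis by (simp only: type_cond.simps tate_ends.simps coeffs_vge_def v_to_vge simp_thms)
  next
    case IV
    with type_cond have "coeffs_vge e 1 1 1 1 2" "vge 2 (wa4 e)" by (auto intro: coeffs_vge_mono) (simp add: coeffs_vge_def)
    with vge_wb8_iff[of e] have "vge 3 (wb8 e)" by simp
    with IV type_cond N2 show ?thesis by (simp only: type_cond.simps tate_ends.simps coeffs_vge_def v_to_vge simp_thms)
  next
    case I0s
    with type_cond have N6: "tate_N6 v e" by (simp only: type_cond.simps tate_N6_def coeffs_vge_def v_to_vge simp_thms)
    with I0s type_cond tate_P_factor_iff(1)[OF \<pi> N6] show ?thesis
      by (simp only: type_cond.simps tate_ends.simps simp_thms)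
  next
    case Ins_pos
    with type_cond have N6: "tate_N6 v e" by (simp only: type_cond.simps tate_N6_def coeffs_vge_def v_to_vge simp_thms)
    with Ins_pos type_cond tate_P_factor_iff(1)[OF \<pi> N6] obtain \<alpha> \<beta> where P: "tate_P_factor v \<pi> e \<alpha> \<beta>"
      by (auto simp only: type_cond.simps)
    then have "vge 0 (\<alpha> - \<beta>)" using vge_diff[of 0 \<alpha> 0 \<beta>] unfolding tate_P_factor_def v_to_vge by simp
    moreover have "\<not> vge 1 (\<alpha> - \<beta>)" using Ins_pos type_cond tate_P_factor_iff(2)[OF \<pi> N6 P] by simp
    ultimately show ?thesis using Ins_pos N6 P by (auto simp only: tate_ends.simps v_to_vge)
  next
    case IVs
    with type_cond tate_Q_repeated_iff[OF \<pi>, of e] have "\<not> tate_Q_repeated v \<pi> e"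
      by (simp add: coeffs_vge_def)
    moreover have "tate_N8 v e"
      using type_cond IVs by (auto simp only: type_cond.simps tate_N8_def tate_N6_def coeffs_vge_def v_to_vge intro: vge_weaken)
    ultimately show ?thesis using IVs by simp
  next
    case IIIs
    with type_cond have "coeffs_vge e 1 2 3 3 5" "coeffs_vge e 1 1 2 2 3" "coeffs_vge e 1 2 2 3 4" by (auto intro: coeffs_vge_mono)
    with IIIs type_cond show ?thesis
      by (simp only: type_cond.simps tate_ends.simps tate_N8_def tate_N6_def coeffs_vge_def v_to_vge simp_thms)
  next
    case IIs
    with type_cond have "coeffs_vge e 1 2 3 4 5" "coeffs_vge e 1 1 2 2 3" "coeffs_vge e 1 2 2 3 4" by (auto intro: coeffs_vge_mono)
    with IIs type_cond show ?thesis
      by (simp only: type_cond.simps tate_ends.simps tate_N8_def tate_N6_def coeffs_vge_def v_to_vge simp_thms)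
  qed
qed

section \<open>The listed conditions, the Kodaira type and the final equivalence\<close>

text \<open>For II, III, III* and II* the two vectors in \<open>min_ratio_eq\<close> differ in a
  single entry, which is the detecting coefficient. For the other types a nonvanishing leading term
  of b6, the cubic discriminant or a2^2 - 3a4 rules out the second vector.\<close>

lemma paper_cond_iff_type_cond: "paper_cond v T e \<longleftrightarrow> type_cond T e"
proof (cases T)
  case II
  show ?thesis
    unfolding II paper_cond.simps type_cond.simps min_ratio_eq by (auto simp: coeffs_vge_def)
next
  case III
  show ?thesis
    unfolding III paper_cond.simps type_cond.simps min_ratio_eq by (auto simp: coeffs_vge_def)
next
  case IV
  have "vge 2 (wb6 e) \<and> \<not> coeffs_vge e 1 1 2 2 3" if "coeffs_vge e 1 1 1 2 2" "\<not> vge 3 (wb6 e)"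
  proof
    have a: "vge 1 (wa3 e)" "vge 2 (wa6 e)" using that unfolding coeffs_vge_def by blast+
    show "vge 2 (wb6 e)" unfolding wb6_def by (rule vge_weaken, (rule a vge_calc)+, simp)
    show "\<not> coeffs_vge e 1 1 2 2 3"
    proof
      assume "coeffs_vge e 1 1 2 2 3"
      then have a: "vge 2 (wa3 e)" "vge 3 (wa6 e)" unfolding coeffs_vge_def by blast+
      have "vge 3 (wb6 e)" unfolding wb6_def by (rule vge_weaken, (rule a vge_calc)+, simp)
      with that show False by blast
    qed
  qed
  then show ?thesis
    unfolding IV paper_cond.simps type_cond.simps min_ratio_eq v_eq_numeral by auto
next
  case I0s
  have "vge 6 (cubic_delta e)" if "coeffs_vge e 1 1 2 2 3"
  proof -
    have a: "vge 1 (wa2 e)" "vge 2 (wa4 e)" "vge 3 (wa6 e)" using that unfolding coeffs_vge_def by blast+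
    show ?thesis unfolding cubic_delta_def disc_monic_cubic_def
      by (rule vge_weaken, (rule a vge_calc)+, simp)
  qed
  with coeffs_vge_cubic_delta[of e] show ?thesis
    unfolding I0s paper_cond.simps type_cond.simps min_ratio_eq v_eq_numeral by auto
next
  case Ins_pos
  have "vge 2 (wa2 e ^ 2 - 3 * wa4 e)" if "coeffs_vge e 1 1 2 2 3"
  proof -
    have a: "vge 1 (wa2 e)" "vge 2 (wa4 e)" using that unfolding coeffs_vge_def by blast+
    show ?thesis by (rule vge_weaken, (rule a vge_calc)+, simp)
  qed
  moreover have "vge 3 (wa2 e ^ 2 - 3 * wa4 e)" if "coeffs_vge e 1 2 2 3 4"
  proof -
    have a: "vge 2 (wa2 e)" "vge 3 (wa4 e)" using that unfolding coeffs_vge_def by blast+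
    show ?thesis by (rule vge_weaken, (rule a vge_calc)+, simp)
  qed
  ultimately show ?thesis
    unfolding Ins_pos paper_cond.simps type_cond.simps min_ratio_eq v_eq_numeral numeral_less_v by auto
next
  case IVs
  have "vge 4 (wb6 e) \<and> \<not> coeffs_vge e 1 2 3 3 5" if "coeffs_vge e 1 2 2 3 4" "\<not> vge 5 (wb6 e)"
  proof
    have a: "vge 2 (wa3 e)" "vge 4 (wa6 e)" using that unfolding coeffs_vge_def by blast+
    show "vge 4 (wb6 e)" unfolding wb6_def by (rule vge_weaken, (rule a vge_calc)+, simp)
    show "\<not> coeffs_vge e 1 2 3 3 5"
    proof
      assume "coeffs_vge e 1 2 3 3 5"
      then have a: "vge 3 (wa3 e)" "vge 5 (wa6 e)" unfolding coeffs_vge_def by blast+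
      have "vge 5 (wb6 e)" unfolding wb6_def by (rule vge_weaken, (rule a vge_calc)+, simp)
      with that show False by blast
    qed
  qed
  then show ?thesis
    unfolding IVs paper_cond.simps type_cond.simps min_ratio_eq v_eq_numeral by auto
next
  case IIIs
  show ?thesis
    unfolding IIIs paper_cond.simps type_cond.simps min_ratio_eq by (auto simp: coeffs_vge_def)
next
  case IIs
  show ?thesis
    unfolding IIs paper_cond.simps type_cond.simps min_ratio_eq by (auto simp: coeffs_vge_def)
qed

lemma kodaira_type_iff: "kodaira_type v e T \<longleftrightarrow> (\<exists>f. weq_iso e f \<and> type_cond T f)"
proof
  assume "kodaira_type v e T"
  then show "\<exists>f. weq_iso e f \<and> type_cond T f"
    unfolding kodaira_type_def integral_weq_iff by (meson tate_ends_imp_type_cond weq_iso_trans)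
next
  assume "\<exists>f. weq_iso e f \<and> type_cond T f"
  then obtain f where f: "weq_iso e f" "type_cond T f" by blast
  obtain \<pi> where \<pi>: "v \<pi> = 1" by (rule uniformizer)
  have "integral_weq v f" using type_cond_minimal[OF f(2)] by (simp add: minimal_model_def)
  then show "kodaira_type v e T"
    unfolding kodaira_type_def using f \<pi> type_cond_imp_tate_ends by blast
qed

end

theorem theorem1:
  fixes v :: "'k::field \<Rightarrow> ereal" and e :: "'k weq"
  assumes "complete_dvf v"
    and "wdisc e \<noteq> 0"
  shows "(additive_reduction v e \<longrightarrow>
            (\<exists>e'. weq_iso e e' \<and> minimal_model v e' \<and>
                  (\<forall>T. kodaira_type v e T \<longrightarrow> paper_cond v T e')))
       \<and> (\<forall>T. paper_cond v T e \<longrightarrow> minimal_model v e \<and> kodaira_type v e T)"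
proof -
  interpret dvf v using assms(1) by unfold_locales (auto simp: complete_dvf_def)
  have "\<exists>f. weq_iso e f \<and> minimal_model v f \<and> (\<forall>T. kodaira_type v e T \<longrightarrow> type_cond T f)"
    if "additive_reduction v e"
  \<comment> \<open>If a type occurs, uniqueness lets one model serve for all \<open>T\<close>; if
    none does, the condition on \<open>T\<close> is vacuous and the minimal model from additive
    reduction is the witness.\<close>
  proof (cases "\<exists>T. kodaira_type v e T")
    case True
    then obtain T f where f: "weq_iso e f" "type_cond T f" unfolding kodaira_type_iff by blast
    have "type_cond T' f" if "kodaira_type v e T'" for T'
    proof -
      obtain f' where "weq_iso e f'" "type_cond T' f'" using \<open>kodaira_type v e T'\<close> unfolding kodaira_type_iff by blast
      moreover from this f(1) have "weq_iso f f'" by (meson weq_iso_sym weq_iso_trans)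
      ultimately have "T = T'" using type_cond_unique f(2) by blast
      with f(2) show ?thesis by blast
    qed
    with f type_cond_minimal show ?thesis by blast
  next
    case False
    with that show ?thesis unfolding additive_reduction_def by blast
  qed
  then show ?thesis
    unfolding paper_cond_iff_type_cond kodaira_type_iff using type_cond_minimal weq_iso_refl by blast
qed

end
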